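(* Let $n\geq1$, $d\geq 3$, $S=\mathbb{C}[x_0,\ldots,x_n]$, let $0\neq f\in S_d$, and let $X=V(f)\subseteq\mathbb{P}^n$. Write $f_i=\partial f/\partial x_i$, $J_f=(f_0,\ldots,f_n)$, $M(f)=S/J_f$ and $e=\operatorname{indeg}(\operatorname{Syz}(J_f))$. Assume that $X$ is not a cone. Then the following are equivalent: (1) $e=1$. (2) The forms $x_jf_i$, $0\leq i,j\leq n$, are linearly dependent in $S_d$. (3) $\dim (J_f)_d<(n+1)^2$. (4) $\dim M(f)_d>\binom{n+d}{n}-(n+1)^2$. (5) $\dim\operatorname{Aut}_{\mathbb{P}^n}(X)>0$.
   Context: $\operatorname{Syz}(J_f)=\{(a_0,\ldots,a_n)\in S^{n+1}\mid\sum_i a_if_i=0\}$, graded by the degree of the coefficients $a_i$; for a graded module $N$, $\operatorname{indeg}(N)$ is the smallest degree $k$ with $N_k\neq0$. $X$ is a cone if, after a linear change of coordinates, $f$ does not depend on all the variables. $\operatorname{Aut}_{\mathbb{P}^n}(X)=\{g\in PGL_{n+1}(\mathbb{C})\mid g(X)=X\}$, understood as the stabilizer of $[f]\in\mathbb{P}(S_d)$: a class represented by $g\in GL_{n+1}(\mathbb{C})$ belongs to it if and only if $f\circ g^{-1}=\lambda f$ for some $\lambda\in\mathbb{C}^*$. *)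

theory Defs
  imports
    "HOL-Analysis.Analysis"
    "HOL-Library.Poly_Mapping"
    "HOL-Algebra.QuotRing"
    "HOL-Algebra.Embedded_Algebras"
begin

section \<open>Polynomials over the complex numbers\<close>

text \<open>A monomial is a finitely supported exponent vector, a polynomial a finitely supported
  family of coefficients. Multiplication on this type is the usual convolution product.\<close>

type_synonym 'v cpoly = "('v \<Rightarrow>\<^sub>0 nat) \<Rightarrow>\<^sub>0 complex"

definition Const :: "complex \<Rightarrow> 'v cpoly"
  where "Const c = Poly_Mapping.single 0 c"

definition Var :: "'v \<Rightarrow> 'v cpoly"
  where "Var i = Poly_Mapping.single (Poly_Mapping.single i 1) 1"

definition mdeg :: "('v::finite \<Rightarrow>\<^sub>0 nat) \<Rightarrow> nat"
  where "mdeg m = (\<Sum>i\<in>UNIV. Poly_Mapping.lookup m i)"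

text \<open>The graded piece of degree \<open>k\<close> of the polynomial ring; it contains \<open>0\<close>.\<close>

definition forms :: "nat \<Rightarrow> 'v::finite cpoly set"
  where "forms k = {p. \<forall>m\<in>Poly_Mapping.keys p. mdeg m = k}"

definition pdiff :: "'v \<Rightarrow> 'v cpoly \<Rightarrow> 'v cpoly"
  where "pdiff i p = (\<Sum>m\<in>Poly_Mapping.keys p.
    Poly_Mapping.single (m - Poly_Mapping.single i 1)
      (of_nat (Poly_Mapping.lookup m i) * Poly_Mapping.lookup p m))"

text \<open>Evaluation at \<open>x\<close> in a ring that receives the coefficients through \<open>h\<close>: this is the value
  at a point for \<open>h\<close> the identity, and a substitution of polynomials for \<open>h = Const\<close>.\<close>

definition poly_eval :: "(complex \<Rightarrow> 'b::comm_ring_1) \<Rightarrow> ('v::finite \<Rightarrow> 'b) \<Rightarrow> 'v cpoly \<Rightarrow> 'b"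
  where "poly_eval h x p = (\<Sum>m\<in>Poly_Mapping.keys p.
    h (Poly_Mapping.lookup p m) * (\<Prod>i\<in>UNIV. x i ^ Poly_Mapping.lookup m i))"

text \<open>\<open>compose_linear f g\<close> is \<open>f \<circ> g\<close>, where \<open>g\<close> acts on column vectors.\<close>

definition compose_linear :: "'n::finite cpoly \<Rightarrow> complex^'n^'n \<Rightarrow> 'n cpoly"
  where "compose_linear f g = poly_eval Const (\<lambda>i. \<Sum>j\<in>UNIV. Const (g $ i $ j) * Var j) f"

definition is_cone :: "'n::finite cpoly \<Rightarrow> bool"
  where "is_cone f \<longleftrightarrow> (\<exists>g. invertible g \<and>
    (\<exists>i. \<forall>m\<in>Poly_Mapping.keys (compose_linear f g). Poly_Mapping.lookup m i = 0))"


section \<open>Jacobian syzygies and the Jacobian algebra\<close>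

definition Syz :: "'n::finite cpoly \<Rightarrow> ('n cpoly ^ 'n) set"
  where "Syz f = {a. (\<Sum>i\<in>UNIV. a $ i * pdiff i f) = 0}"

text \<open>The initial degree is meaningful for nonzero graded \<open>N\<close> only. For at least two variables
  \<open>Syz f\<close> is nonzero, because of the Koszul relations (or trivially if some partial vanishes).\<close>

definition indeg :: "('n::finite cpoly ^ 'n) set \<Rightarrow> nat"
  where "indeg N = (LEAST k. N \<inter> {a. \<forall>i. a $ i \<in> forms k} \<noteq> {0})"

definition poly_ring :: "'v cpoly ring"
  where "poly_ring = \<lparr>carrier = UNIV, monoid.mult = (*), one = 1, zero = 0, add = (+)\<rparr>"

definition jacobian_ideal :: "'n cpoly \<Rightarrow> 'n cpoly set"
  where "jacobian_ideal f = Idl\<^bsub>poly_ring\<^esub> {pdiff i f | i. True}"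

definition jacobian_algebra :: "'n cpoly \<Rightarrow> 'n cpoly set ring"
  where "jacobian_algebra f = poly_ring Quot (jacobian_ideal f)"

definition residue_class :: "'n cpoly \<Rightarrow> 'n cpoly \<Rightarrow> 'n cpoly set"
  where "residue_class f p = jacobian_ideal f +>\<^bsub>poly_ring\<^esub> p"

text \<open>The dimension of a subspace \<open>E\<close> of the ring \<open>R\<close> over a subfield \<open>K\<close> of \<open>R\<close>.\<close>

definition vdim :: "('a, 'b) ring_scheme \<Rightarrow> 'a set \<Rightarrow> 'a set \<Rightarrow> nat"
  where "vdim R K E = (THE k. ring.dimension R k K E)"

text \<open>The dimensions of the degree \<open>k\<close> pieces of the Jacobian ideal and of the Jacobian algebra.
  In the polynomial ring the ground field is the set of constants, in the quotient its image.\<close>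

definition dim_jacobian_ideal :: "'n::finite cpoly \<Rightarrow> nat \<Rightarrow> nat"
  where "dim_jacobian_ideal f k =
    vdim poly_ring {Const c | c. True} (jacobian_ideal f \<inter> forms k)"

definition dim_jacobian_algebra :: "'n::finite cpoly \<Rightarrow> nat \<Rightarrow> nat"
  where "dim_jacobian_algebra f k =
    vdim (jacobian_algebra f) (residue_class f ` {Const c | c. True}) (residue_class f ` forms k)"

lemma poly_ring_cring: "cring (poly_ring :: 'v cpoly ring)"
proof (rule cringI)
  show "abelian_group (poly_ring :: 'v cpoly ring)"
  proof (rule abelian_groupI)
    fix x assume "x \<in> carrier (poly_ring :: 'v cpoly ring)"
    show "\<exists>y\<in>carrier poly_ring. y \<oplus>\<^bsub>poly_ring\<^esub> x = \<zero>\<^bsub>poly_ring\<^esub>"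
      by (rule bexI[of _ "- x"]) (simp_all add: poly_ring_def)
  qed (simp_all add: poly_ring_def add_ac)
  show "comm_monoid (poly_ring :: 'v cpoly ring)"
    by (rule comm_monoidI) (simp_all add: poly_ring_def mult_ac)
qed (simp add: poly_ring_def distrib_right)


section \<open>The projective linear group and its Zariski topology\<close>

definition GL :: "(complex^'n::finite^'n) monoid"
  where "GL = \<lparr>carrier = {g. invertible g}, monoid.mult = (**), one = mat 1\<rparr>"

definition scalar_matrices :: "(complex^'n::finite^'n) set"
  where "scalar_matrices = {mat c | c. c \<noteq> 0}"

definition PGL :: "(complex^'n::finite^'n) set monoid"
  where "PGL = GL Mod scalar_matrices"

lemma mat_mult_left: "mat c ** g = ((\<chi> i j. c * g $ i $ j) :: complex^'n::finite^'n)"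
proof -
  have "(\<Sum>k\<in>UNIV. (if i = k then c else 0) * g $ k $ j) = c * g $ i $ j" for i j
  proof -
    have "(\<Sum>k\<in>UNIV. (if i = k then c else 0) * g $ k $ j)
        = (\<Sum>k\<in>UNIV. if i = k then c * g $ k $ j else 0)"
      by (intro sum.cong) auto
    then show ?thesis by simp
  qed
  then show ?thesis by (simp add: vec_eq_iff matrix_matrix_mult_def mat_def)
qed

lemma mat_mult_right: "g ** mat c = ((\<chi> i j. c * g $ i $ j) :: complex^'n::finite^'n)"
proof -
  have "(\<Sum>k\<in>UNIV. g $ i $ k * (if k = j then c else 0)) = c * g $ i $ j" for i j
  proof -
    have "(\<Sum>k\<in>UNIV. g $ i $ k * (if k = j then c else 0))
        = (\<Sum>k\<in>UNIV. if k = j then c * g $ i $ k else 0)"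
      by (intro sum.cong) auto
    then show ?thesis by simp
  qed
  then show ?thesis by (simp add: vec_eq_iff matrix_matrix_mult_def mat_def)
qed

lemma mat_mult_mat: "mat c ** mat d = (mat (c * d) :: complex^'n::finite^'n)"
  unfolding mat_mult_left by (simp add: vec_eq_iff mat_def)

lemma invertible_mat: "c \<noteq> 0 \<Longrightarrow> invertible (mat c :: complex^'n::finite^'n)"
  unfolding invertible_def by (rule exI[of _ "mat (1 / c)"]) (simp add: mat_mult_mat)

lemma GL_group: "group (GL :: (complex^'n::finite^'n) monoid)"
proof (rule groupI)
  fix x :: "complex^'n::finite^'n" assume "x \<in> carrier GL"
  then obtain y where "x ** y = mat 1" "y ** x = mat 1" by (auto simp: GL_def invertible_def)
  then show "\<exists>y\<in>carrier GL. y \<otimes>\<^bsub>GL\<^esub> x = \<one>\<^bsub>GL\<^esub>"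
    by (intro bexI[of _ y]) (auto simp: GL_def invertible_def)
qed (auto simp: GL_def invertible_mult matrix_mul_assoc invertible_mat)

lemma scalar_matrices_normal: "scalar_matrices \<lhd> (GL :: (complex^'n::finite^'n) monoid)"
proof -
  interpret group "GL :: (complex^'n::finite^'n) monoid" by (rule GL_group)
  have inv: "inv\<^bsub>GL\<^esub> (mat c) = (mat (1 / c) :: complex^'n^'n)" if "c \<noteq> 0" for c
    using that by (intro inv_equality) (auto simp: GL_def mat_mult_mat invertible_mat)
  have "subgroup scalar_matrices (GL :: (complex^'n::finite^'n) monoid)"
  proof
    fix x y :: "complex^'n^'n"
    assume "x \<in> scalar_matrices" "y \<in> scalar_matrices"
    then obtain c d where "x = mat c" "y = mat d" "c \<noteq> 0" "d \<noteq> 0"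
      by (auto simp: scalar_matrices_def)
    then show "x \<otimes>\<^bsub>GL\<^esub> y \<in> scalar_matrices"
      by (auto simp: GL_def scalar_matrices_def mat_mult_mat intro!: exI[of _ "c * d"])
  next
    fix x :: "complex^'n^'n"
    assume "x \<in> scalar_matrices"
    then obtain c where "x = mat c" "c \<noteq> 0" by (auto simp: scalar_matrices_def)
    then show "inv\<^bsub>GL\<^esub> x \<in> scalar_matrices"
      by (auto simp: inv scalar_matrices_def intro!: exI[of _ "1 / c"])
  qed (auto simp: GL_def scalar_matrices_def invertible_mat intro!: exI[of _ 1])
  then show ?thesis
  proof (rule normalI, intro ballI)
    fix x :: "complex^'n^'n"
    show "scalar_matrices #>\<^bsub>GL\<^esub> x = x <#\<^bsub>GL\<^esub> scalar_matrices"
      by (auto simp: r_coset_def l_coset_def scalar_matrices_def GL_def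
          mat_mult_left mat_mult_right)
  qed
qed

text \<open>\<open>PGL\<close> is regarded as an open subset of the projective space of matrices: its Zariski closed
  subsets are the zero loci of sets of homogeneous polynomials in the matrix entries.\<close>

definition matrix_poly_eval :: "('n::finite \<times> 'n) cpoly \<Rightarrow> complex^'n^'n \<Rightarrow> complex"
  where "matrix_poly_eval F g = poly_eval (\<lambda>c. c) (\<lambda>(i, j). g $ i $ j) F"

definition PGL_zeros :: "('n::finite \<times> 'n) cpoly set \<Rightarrow> (complex^'n^'n) set set"
  where "PGL_zeros E = {P \<in> carrier PGL. \<forall>F\<in>E. \<forall>g\<in>P. matrix_poly_eval F g = 0}"

definition zariski_PGL :: "(complex^'n::finite^'n) set topology"
  where "zariski_PGL = topology (\<lambda>U. U \<subseteq> carrier PGL \<and>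
    (\<exists>E \<subseteq> (\<Union>k. forms k). carrier PGL - U = PGL_zeros E))"

text \<open>The automorphism group of the hypersurface, understood as the stabilizer of the class of \<open>f\<close>
  in the projective space of forms; the condition does not depend on the representative \<open>g\<close>.\<close>

definition Aut :: "'n::finite cpoly \<Rightarrow> (complex^'n^'n) set set"
  where "Aut f = {scalar_matrices #>\<^bsub>GL\<^esub> g | g. g \<in> carrier GL \<and>
    (\<exists>c. c \<noteq> 0 \<and> compose_linear f (matrix_inv g) = Const c * f)}"


section \<open>Krull dimension of a topological space\<close>

definition irreducible_closed :: "'a topology \<Rightarrow> 'a set \<Rightarrow> bool"
  where "irreducible_closed T Z \<longleftrightarrow> closedin T Z \<and> Z \<noteq> {} \<and>
    (\<forall>A B. closedin T A \<and> closedin T B \<and> Z = A \<union> B \<longrightarrow> Z = A \<or> Z = B)"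

text \<open>The supremum of the lengths of chains of irreducible closed subsets
  (and \<open>0\<close> for the empty space).\<close>

definition krull_dim :: "'a topology \<Rightarrow> enat"
  where "krull_dim T = Sup {enat k | k. \<exists>Z :: nat \<Rightarrow> 'a set.
    (\<forall>i\<le>k. irreducible_closed T (Z i)) \<and> (\<forall>i<k. Z i \<subset> Z (Suc i))}"


section \<open>The Zariski topology is a topology\<close>

lemma poly_eval_superset:
  assumes "finite A" "Poly_Mapping.keys p \<subseteq> A"
  shows "poly_eval (\<lambda>c. c) x p =
    (\<Sum>m\<in>A. Poly_Mapping.lookup p m * (\<Prod>i\<in>UNIV. x i ^ Poly_Mapping.lookup m i))"
  unfolding poly_eval_def using assms
  by (intro sum.mono_neutral_left) (auto simp: in_keys_iff)

lemma poly_eval_add: "poly_eval (\<lambda>c. c) x (p + q) = poly_eval (\<lambda>c. c) x p + poly_eval (\<lambda>c. c) x q"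
proof -
  let ?A = "Poly_Mapping.keys p \<union> Poly_Mapping.keys q"
  have "Poly_Mapping.keys (p + q) \<subseteq> ?A" by (rule Poly_Mapping.keys_add)
  then show ?thesis
    by (simp add: poly_eval_superset[of ?A] lookup_add distrib_right sum.distrib)
qed

lemma poly_eval_sum: "poly_eval (\<lambda>c. c) x (\<Sum>a\<in>A. p a) = (\<Sum>a\<in>A. poly_eval (\<lambda>c. c) x (p a))"
proof (induction A rule: infinite_finite_induct)
  case (insert a A)
  then show ?case by (simp add: poly_eval_add)
qed (simp_all add: poly_eval_def)

lemma poly_eval_single:
  "poly_eval (\<lambda>c. c) x (Poly_Mapping.single m c) = c * (\<Prod>i\<in>UNIV. x i ^ Poly_Mapping.lookup m i)"
  by (simp add: poly_eval_superset[of "{m}"])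

lemma poly_sum_monomials:
  "(\<Sum>m\<in>Poly_Mapping.keys p. Poly_Mapping.single m (Poly_Mapping.lookup p m)) = (p :: 'v cpoly)"
  by (rule poly_mapping_eqI)
    (auto simp: lookup_sum lookup_single when_def in_keys_iff sum.delta)

lemma poly_eval_mult: "poly_eval (\<lambda>c. c) x (p * q) = poly_eval (\<lambda>c. c) x p * poly_eval (\<lambda>c. c) x q"
proof -
  let ?s = "\<lambda>p m. Poly_Mapping.single m (Poly_Mapping.lookup p m)"
  have "p * q = (\<Sum>m\<in>Poly_Mapping.keys p. ?s p m) * (\<Sum>m\<in>Poly_Mapping.keys q. ?s q m)"
    by (simp only: poly_sum_monomials)
  also have "\<dots> = (\<Sum>m\<in>Poly_Mapping.keys p. \<Sum>m'\<in>Poly_Mapping.keys q. ?s p m * ?s q m')"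
    by (rule sum_product)
  finally have "poly_eval (\<lambda>c. c) x (p * q) = (\<Sum>m\<in>Poly_Mapping.keys p. \<Sum>m'\<in>Poly_Mapping.keys q.
      poly_eval (\<lambda>c. c) x (?s p m) * poly_eval (\<lambda>c. c) x (?s q m'))"
    by (simp add: poly_eval_sum mult_single poly_eval_single lookup_add power_add
        prod.distrib mult_ac)
  also have "\<dots> = poly_eval (\<lambda>c. c) x p * poly_eval (\<lambda>c. c) x q"
    unfolding poly_eval_single by (simp add: poly_eval_def sum_product)
  finally show ?thesis .
qed

lemma forms_mult: "p \<in> forms k \<Longrightarrow> q \<in> forms l \<Longrightarrow> p * q \<in> forms (k + l)"
  using keys_mult[of p q]
  by (fastforce simp: forms_def mdeg_def lookup_add sum.distrib)

lemma matrix_poly_eval_scale: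
  assumes "F \<in> forms k"
  shows "matrix_poly_eval F (mat c ** g) = c ^ k * matrix_poly_eval F g"
proof -
  have "(\<Prod>i\<in>UNIV. (c * x i) ^ Poly_Mapping.lookup m i)
      = c ^ k * (\<Prod>i\<in>UNIV. x i ^ Poly_Mapping.lookup m i)"
    if "m \<in> Poly_Mapping.keys F" for m and x :: "'a \<times> 'a \<Rightarrow> complex"
    using that assms
    by (simp add: forms_def mdeg_def power_mult_distrib prod.distrib power_sum[symmetric])
  then show ?thesis
    by (simp add: matrix_poly_eval_def poly_eval_def mat_mult_left case_prod_beta
        sum_distrib_left mult_ac cong: sum.cong)
qed

lemma PGL_elements_proportional:
  assumes "P \<in> carrier PGL" "g \<in> P" "h \<in> P"
  shows "\<exists>c. c \<noteq> 0 \<and> h = mat c ** g"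
proof -
  obtain a where "P = scalar_matrices #>\<^bsub>GL\<^esub> a"
    using assms by (auto simp: PGL_def FactGroup_def RCOSETS_def)
  then obtain c d where "g = mat c ** a" "h = mat d ** a" "c \<noteq> 0" "d \<noteq> 0"
    using assms by (auto simp: r_coset_def scalar_matrices_def GL_def)
  then show ?thesis
    by (intro exI[of _ "d / c"]) (simp add: matrix_mul_assoc mat_mult_mat)
qed

lemma istopology_zariski_PGL:
  "istopology (\<lambda>U :: (complex^'n::finite^'n) set set. U \<subseteq> carrier PGL \<and>
    (\<exists>E \<subseteq> (\<Union>k. forms k). carrier PGL - U = PGL_zeros E))"
  unfolding istopology_def
proof (intro conjI allI impI)
  fix U V :: "(complex^'n^'n) set set"
  assume U: "U \<subseteq> carrier PGL \<and> (\<exists>E \<subseteq> (\<Union>k. forms k). carrier PGL - U = PGL_zeros E)"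
    and V: "V \<subseteq> carrier PGL \<and> (\<exists>E \<subseteq> (\<Union>k. forms k). carrier PGL - V = PGL_zeros E)"
  then show "U \<inter> V \<subseteq> carrier PGL" by blast
  from U V obtain E E' where E: "E \<subseteq> (\<Union>k. forms k)" "carrier PGL - U = PGL_zeros E"
    and E': "E' \<subseteq> (\<Union>k. forms k)" "carrier PGL - V = PGL_zeros E'" by blast
  let ?E = "{F * G | F G. F \<in> E \<and> G \<in> E'}"
  have "PGL_zeros ?E = PGL_zeros E \<union> PGL_zeros E'"
  proof (intro equalityI subsetI)
    fix P assume P: "P \<in> PGL_zeros ?E"
    then have P': "P \<in> carrier PGL" by (simp add: PGL_zeros_def)
    show "P \<in> PGL_zeros E \<union> PGL_zeros E'"
    proof (rule ccontr)
      assume "P \<notin> PGL_zeros E \<union> PGL_zeros E'"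
      then obtain F G g h where *: "F \<in> E" "G \<in> E'" "g \<in> P" "h \<in> P"
        "matrix_poly_eval F g \<noteq> 0" "matrix_poly_eval G h \<noteq> 0"
        using P' by (auto simp: PGL_zeros_def)
      obtain c where c: "c \<noteq> 0" "g = mat c ** h"
        using PGL_elements_proportional[OF P' *(4) *(3)] by blast
      obtain k where "G \<in> forms k" using * E' by blast
      then have "matrix_poly_eval G g \<noteq> 0"
        using c * by (simp add: matrix_poly_eval_scale)
      then have "matrix_poly_eval (F * G) g \<noteq> 0"
        using * by (simp add: matrix_poly_eval_def poly_eval_mult)
      then show False using P * by (auto simp: PGL_zeros_def)
    qed
  next
    fix P assume "P \<in> PGL_zeros E \<union> PGL_zeros E'"
    then show "P \<in> PGL_zeros ?E"
      by (auto simp: PGL_zeros_def matrix_poly_eval_def poly_eval_mult)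
  qed
  then have "carrier PGL - U \<inter> V = PGL_zeros ?E"
    unfolding E(2)[symmetric] E'(2)[symmetric] by (simp only: Diff_Int)
  moreover have "?E \<subseteq> (\<Union>k. forms k)"
  proof
    fix H assume "H \<in> ?E"
    then obtain F G where H: "H = F * G" "F \<in> E" "G \<in> E'" by blast
    then obtain k l where "F \<in> forms k" "G \<in> forms l" using E(1) E'(1) by blast
    then show "H \<in> (\<Union>k. forms k)" unfolding H(1) using forms_mult by blast
  qed
  ultimately show "\<exists>E \<subseteq> (\<Union>k. forms k). carrier PGL - U \<inter> V = PGL_zeros E"
    by (intro exI[of _ ?E] conjI)
next
  fix \<U> :: "(complex^'n^'n) set set set"
  assume *: "\<forall>U\<in>\<U>. U \<subseteq> carrier PGL \<and>
    (\<exists>E \<subseteq> (\<Union>k. forms k). carrier PGL - U = PGL_zeros E)"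
  then show "\<Union>\<U> \<subseteq> carrier PGL" by blast
  from * obtain E where E: "\<And>U. U \<in> \<U> \<Longrightarrow> E U \<subseteq> (\<Union>k. forms k)"
    "\<And>U. U \<in> \<U> \<Longrightarrow> carrier PGL - U = PGL_zeros (E U)" by metis
  have "carrier PGL - \<Union>\<U> = {P \<in> carrier PGL. \<forall>U\<in>\<U>. P \<in> carrier PGL - U}"
    by blast
  also have "\<dots> = {P \<in> carrier PGL. \<forall>U\<in>\<U>. P \<in> PGL_zeros (E U)}"
    using E(2) by simp
  also have "\<dots> = PGL_zeros (\<Union>U\<in>\<U>. E U)"
    by (auto simp: PGL_zeros_def)
  finally have "carrier PGL - \<Union>\<U> = PGL_zeros (\<Union>U\<in>\<U>. E U)" .
  then show "\<exists>E \<subseteq> (\<Union>k. forms k). carrier PGL - \<Union>\<U> = PGL_zeros E"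
    using E(1) by (intro exI[of _ "\<Union>U\<in>\<U>. E U"] conjI UN_least)
qed

lemma openin_zariski_PGL:
  "openin zariski_PGL U \<longleftrightarrow> U \<subseteq> carrier PGL \<and>
    (\<exists>E \<subseteq> (\<Union>k. forms k). carrier PGL - U = PGL_zeros E)"
  unfolding zariski_PGL_def topology_inverse'[OF istopology_zariski_PGL] ..

lemma topspace_zariski_PGL: "topspace zariski_PGL = carrier PGL"
proof
  have "PGL_zeros {1 :: ('a \<times> 'a) cpoly} = {}"
  proof -
    have "matrix_poly_eval 1 g = 1" for g :: "complex^'a^'a"
      using poly_eval_single[of _ 0 1] by (simp add: matrix_poly_eval_def)
    moreover have "P \<noteq> {}" if P: "P \<in> carrier PGL" for P :: "(complex^'a^'a) set"
    proof -
      obtain a where "P = scalar_matrices #>\<^bsub>GL\<^esub> a"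
        using P by (auto simp: PGL_def FactGroup_def RCOSETS_def)
      then show ?thesis by (auto simp: r_coset_def scalar_matrices_def)
    qed
    ultimately show ?thesis by (auto simp: PGL_zeros_def)
  qed
  moreover have "(1 :: ('a \<times> 'a) cpoly) \<in> forms 0" by (simp add: forms_def mdeg_def)
  ultimately have "openin zariski_PGL (carrier (PGL :: (complex^'a^'a) set monoid))"
    unfolding openin_zariski_PGL by (intro conjI exI[of _ "{1}"]) auto
  then show "carrier PGL \<subseteq> topspace (zariski_PGL :: (complex^'a^'a) set topology)"
    by (rule openin_subset)
  show "topspace (zariski_PGL :: (complex^'a^'a) set topology) \<subseteq> carrier PGL"
    using openin_topspace[of "zariski_PGL :: (complex^'a^'a) set topology"]
    unfolding openin_zariski_PGL by blast
qed

lemma closedin_zariski_PGL: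
  "closedin zariski_PGL Z \<longleftrightarrow> (\<exists>E \<subseteq> (\<Union>k. forms k). Z = PGL_zeros E)"
proof -
  have "carrier PGL - (carrier PGL - Z) = Z" if "Z \<subseteq> carrier PGL" using that by blast
  moreover have "PGL_zeros E \<subseteq> carrier PGL" for E :: "('a \<times> 'a) cpoly set"
    by (auto simp: PGL_zeros_def)
  ultimately show ?thesis
    unfolding closedin_def topspace_zariski_PGL openin_zariski_PGL by (metis Diff_subset)
qed

end

theory Submission
  imports Defs "HOL-Complex_Analysis.Conformal_Mappings"
begin

text \<open>
  All five conditions say that some nonzero matrix \<open>B\<close> is an infinitesimal symmetry of \<open>f\<close>, i.e.
  \<open>\<Sum>i (B x)\<^sub>i f\<^sub>i = 0\<close>. For (1)--(4) this is linear algebra, since \<open>(J\<^sub>f)\<^sub>d\<close> is spanned by the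
  \<open>(n + 1)\<^sup>2\<close> forms \<open>x\<^sub>j f\<^sub>i\<close>, and there are no syzygies of degree 0 because \<open>X\<close> is not a cone.

  For (5), a nonzero \<open>B\<close> is not a scalar matrix (Euler), and the one-parameter group \<open>exp (t B)\<close> fixes
  \<open>f\<close>. Its Zariski closure is irreducible, because polynomials restrict to entire functions of \<open>t\<close>,
  and it has more than one point.

  Conversely, without infinitesimal symmetries \<open>g \<mapsto> f \<circ> g\<close> is an immersion on the invertible
  matrices, so every element of the stabilizer \<open>V\<close> of \<open>f\<close> is a nondegenerate solution of one of
  finitely many square polynomial systems \<open>f (g x\<^sub>i) = f (x\<^sub>i)\<close>, the \<open>x\<^sub>i\<close> taken from a finite grid. A
  square system \<open>G = b\<close> has only finitely many nondegenerate solutions: a coordinate \<open>L\<close> satisfies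
  an algebraic relation \<open>R(L, G) = 0\<close>, and nearby fibers of \<open>G\<close> contain points near every
  nondegenerate solution, whose \<open>L\<close>-coordinates are roots of a nonzero univariate polynomial. So \<open>V\<close>
  and the automorphism group are finite, and a finite T1 space has dimension 0.
\<close>

section \<open>Evaluation and derivatives of polynomials\<close>

abbreviation ev :: "('v::finite \<Rightarrow> complex) \<Rightarrow> 'v cpoly \<Rightarrow> complex"
  where "ev \<equiv> poly_eval (\<lambda>c. c)"

lemma ev_0 [simp]: "ev x 0 = 0"
  by (simp add: poly_eval_def)

lemma ev_Const [simp]: "ev x (Const c) = c"
  by (simp add: Const_def poly_eval_single)

lemma ev_1 [simp]: "ev x 1 = 1"
  using ev_Const[of x 1] by (simp add: Const_def)

lemma ev_Var [simp]: "ev x (Var i) = x i"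
proof -
  have "(\<Prod>j\<in>UNIV. x j ^ Poly_Mapping.lookup (Poly_Mapping.single i (1::nat)) j)
      = (\<Prod>j\<in>UNIV. if j = i then x i else 1)"
    by (intro prod.cong) (auto simp: lookup_single when_def)
  then show ?thesis by (simp add: Var_def poly_eval_single)
qed

lemma ev_uminus [simp]: "ev x (- p) = - ev x p"
  using poly_eval_add[of x p "- p"] by (simp add: eq_neg_iff_add_eq_0 add.commute)

lemma ev_diff [simp]: "ev x (p - q) = ev x p - ev x q"
  using poly_eval_add[of x p "- q"] by simp

lemma ev_power [simp]: "ev x (p ^ k) = ev x p ^ k"
  by (induction k) (simp_all add: poly_eval_mult)

lemma ev_prod: "ev x (\<Prod>a\<in>A. p a) = (\<Prod>a\<in>A. ev x (p a))"
  by (induction A rule: infinite_finite_induct) (simp_all add: poly_eval_mult)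

lemmas ev_simps = poly_eval_add poly_eval_sum poly_eval_mult ev_prod

lemma Const_0 [simp]: "Const 0 = 0" and Const_1 [simp]: "Const 1 = 1"
  by (simp_all add: Const_def)

lemma Const_add: "Const (a + b) = Const a + Const b"
  and Const_mult: "Const (a * b) = Const a * Const b"
  and Const_uminus: "Const (- a) = - Const a"
  by (simp_all add: Const_def single_add mult_single single_uminus)

lemma lookup_Const_mult: "Poly_Mapping.lookup (Const c * p) m = c * Poly_Mapping.lookup p m"
proof -
  have "Const c * p = Poly_Mapping.map ((*) c) p"
    by (simp add: Const_def mult_map_scale_conv_mult)
  then show ?thesis by (simp add: map.rep_eq when_def)
qed

lemma single_eq_Const_mult: "Poly_Mapping.single m c = Const c * Poly_Mapping.single m 1"
  by (simp add: Const_def mult_single)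

text \<open>The coefficient of the derivative at \<open>m\<close> comes from the single monomial
  obtained by raising the exponent of \<open>i\<close> by one. This makes it possible to read off
  from \<open>pdiff i p = 0\<close> which coefficients of \<open>p\<close> vanish.\<close>

lemma lookup_pdiff: "Poly_Mapping.lookup (pdiff i p) m =
    of_nat (Suc (Poly_Mapping.lookup m i)) * Poly_Mapping.lookup p (m + Poly_Mapping.single i 1)"
proof -
  let ?e = "Poly_Mapping.single i (1::nat)"
  \<comment> \<open>Subtraction of exponents truncates at 0, so a monomial without the variable
    \<open>i\<close> may also be sent to \<open>m\<close>. Its term carries the factor 0, which is
    why the exponent of \<open>i\<close> is required to be nonzero.\<close>
  have *: "m' - ?e = m \<and> Poly_Mapping.lookup m' i \<noteq> 0 \<longleftrightarrow> m' = m + ?e" for m'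
  proof
    assume A: "m' - ?e = m \<and> Poly_Mapping.lookup m' i \<noteq> 0"
    show "m' = m + ?e"
    proof (rule poly_mapping_eqI)
      fix k show "Poly_Mapping.lookup m' k = Poly_Mapping.lookup (m + ?e) k"
        using A by (auto simp: lookup_add lookup_minus lookup_single when_def)
    qed
  qed (auto simp: lookup_add)
  have "Poly_Mapping.lookup (pdiff i p) m = (\<Sum>m'\<in>Poly_Mapping.keys p.
      if m' = m + ?e then of_nat (Suc (Poly_Mapping.lookup m i)) * Poly_Mapping.lookup p m' else 0)"
    unfolding pdiff_def lookup_sum
  proof (intro sum.cong refl)
    fix m'
    show "Poly_Mapping.lookup (Poly_Mapping.single (m' - ?e)
        (of_nat (Poly_Mapping.lookup m' i) * Poly_Mapping.lookup p m')) m
      = (if m' = m + ?e then of_nat (Suc (Poly_Mapping.lookup m i)) * Poly_Mapping.lookup p m' else 0)"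
      using *[of m'] by (auto simp: lookup_single when_def lookup_add)
  qed
  then show ?thesis by (auto simp: in_keys_iff)
qed

lemma pdiff_forms: "p \<in> forms (Suc k) \<Longrightarrow> pdiff i p \<in> forms k"
proof -
  assume p: "p \<in> forms (Suc k)"
  have "mdeg m = k" if "m \<in> Poly_Mapping.keys (pdiff i p)" for m
  proof -
    have "m + Poly_Mapping.single i 1 \<in> Poly_Mapping.keys p"
      using that by (auto simp: in_keys_iff lookup_pdiff)
    then have "mdeg (m + Poly_Mapping.single i 1) = Suc k" using p by (auto simp: forms_def)
    then show ?thesis
      by (simp add: mdeg_def lookup_add sum.distrib lookup_single when_def)
  qed
  then show ?thesis by (simp add: forms_def)
qed

text \<open>This is the chain rule. The parameter ranges over a real normed space, so the rule
  covers complex curves as well as the map \<open>F\<close> on \<open>complex^'v\<close> in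
  \<open>finite_nondegenerate_fiber\<close>, where the open mapping theorem asks for a real
  derivative only.\<close>

lemma has_derivative_ev:
  fixes X :: "'a::real_normed_vector \<Rightarrow> 'v::finite \<Rightarrow> complex"
  assumes X: "\<And>i. ((\<lambda>y. X y i) has_derivative X' i) (at y)"
  shows "((\<lambda>y. ev (X y) p) has_derivative (\<lambda>h. \<Sum>i\<in>UNIV. X' i h * ev (X y) (pdiff i p))) (at y)"
proof -
  let ?l = "Poly_Mapping.lookup"
  have "((\<lambda>y. \<Sum>m\<in>Poly_Mapping.keys p. ?l p m * (\<Prod>i\<in>UNIV. X y i ^ ?l m i)) has_derivative
     (\<lambda>h. \<Sum>m\<in>Poly_Mapping.keys p. ?l p m * (\<Sum>i\<in>UNIV. (of_nat (?l m i) * X' i h * X y i ^ (?l m i - 1))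
        * (\<Prod>j\<in>UNIV - {i}. X y j ^ ?l m j)))) (at y)"
    by (intro derivative_intros X)
  moreover have "(\<Sum>m\<in>Poly_Mapping.keys p. ?l p m * (\<Sum>i\<in>UNIV. (of_nat (?l m i) * X' i h * X y i ^ (?l m i - 1))
        * (\<Prod>j\<in>UNIV - {i}. X y j ^ ?l m j))) = (\<Sum>i\<in>UNIV. X' i h * ev (X y) (pdiff i p))" for h
  proof -
    have "(\<Prod>j\<in>UNIV. X y j ^ ?l (m - Poly_Mapping.single i 1) j)
        = X y i ^ (?l m i - 1) * (\<Prod>j\<in>UNIV - {i}. X y j ^ ?l m j)" for m i
    proof -
      have "(\<Prod>j\<in>UNIV. X y j ^ ?l (m - Poly_Mapping.single i 1) j)
        = X y i ^ (?l (m - Poly_Mapping.single i 1) i)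
          * (\<Prod>j\<in>UNIV - {i}. X y j ^ ?l (m - Poly_Mapping.single i 1) j)"
        by (rule prod.remove) auto
      also have "(\<Prod>j\<in>UNIV - {i}. X y j ^ ?l (m - Poly_Mapping.single i 1) j)
        = (\<Prod>j\<in>UNIV - {i}. X y j ^ ?l m j)"
        by (intro prod.cong) (auto simp: lookup_minus lookup_single when_def)
      finally show ?thesis by (simp add: lookup_minus)
    qed
    then have "ev (X y) (pdiff i p) = (\<Sum>m\<in>Poly_Mapping.keys p. of_nat (?l m i) * ?l p m *
        (X y i ^ (?l m i - 1) * (\<Prod>j\<in>UNIV - {i}. X y j ^ ?l m j)))" for i
      by (simp add: pdiff_def poly_eval_sum poly_eval_single)
    then have "(\<Sum>i\<in>UNIV. X' i h * ev (X y) (pdiff i p)) = (\<Sum>i\<in>UNIV. \<Sum>m\<in>Poly_Mapping.keys p.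
        X' i h * (of_nat (?l m i) * ?l p m * (X y i ^ (?l m i - 1) * (\<Prod>j\<in>UNIV - {i}. X y j ^ ?l m j))))"
      by (simp add: sum_distrib_left)
    also have "\<dots> = (\<Sum>m\<in>Poly_Mapping.keys p. \<Sum>i\<in>UNIV.
        X' i h * (of_nat (?l m i) * ?l p m * (X y i ^ (?l m i - 1) * (\<Prod>j\<in>UNIV - {i}. X y j ^ ?l m j))))"
      by (rule sum.swap)
    finally show ?thesis by (simp add: sum_distrib_left mult_ac)
  qed
  ultimately show ?thesis by (simp add: poly_eval_def)
qed

lemma has_field_derivative_ev:
  assumes X: "\<And>i. ((\<lambda>t. X t i) has_field_derivative X' i) (at t)"
  shows "((\<lambda>t. ev (X t) p) has_field_derivative (\<Sum>i\<in>UNIV. X' i * ev (X t) (pdiff i p))) (at t)"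
proof -
  have "((\<lambda>t. ev (X t) p) has_derivative (\<lambda>h. \<Sum>i\<in>UNIV. X' i * h * ev (X t) (pdiff i p))) (at t)"
    by (rule has_derivative_ev) (use X in \<open>simp add: has_field_derivative_def\<close>)
  then show ?thesis
    by (rule has_derivative_imp_has_field_derivative) (simp add: sum_distrib_left mult_ac)
qed

text \<open>Induction on a bound \<open>D\<close> for the total degree. The partial derivatives
  vanish as functions, so \<open>pdiff i p = 0\<close> by induction; in characteristic 0 this
  removes every monomial containing the variable \<open>i\<close>, and a constant polynomial is
  determined by one value.\<close>

lemma cpoly_eq_0I:
  fixes p :: "'v::finite cpoly"
  assumes "\<And>x. ev x p = 0"
  shows "p = 0"
proof -
  have "p = 0" if "\<And>x. ev x p = 0" "\<And>m. m \<in> Poly_Mapping.keys p \<Longrightarrow> mdeg m \<le> D"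
    for D and p :: "'v cpoly"
    using that
  proof (induction D arbitrary: p rule: less_induct)
    case (less D)
    have key0: "m = 0" if m: "m \<in> Poly_Mapping.keys p" for m
    proof (rule ccontr)
      assume "m \<noteq> 0"
      then obtain i where i: "Poly_Mapping.lookup m i \<noteq> 0" by (metis poly_mapping_eqI lookup_zero)
      let ?m = "m - Poly_Mapping.single i 1"
      have m': "?m + Poly_Mapping.single i 1 = m"
        using i by (intro poly_mapping_eqI) (auto simp: lookup_add lookup_minus lookup_single when_def)
      have "mdeg m \<noteq> 0" using i by (auto simp: mdeg_def)
      then have D: "D - 1 < D" using less.prems(2)[OF m] by simp
      have "pdiff i p = 0"
      proof (rule less.IH[OF D])
        fix x :: "'v \<Rightarrow> complex"
        have "((\<lambda>t. ev (\<lambda>j. x j + (if j = i then t else 0)) p) has_field_derivative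
          (\<Sum>j\<in>UNIV. (if j = i then 1 else 0) * ev (\<lambda>j. x j + (if j = i then 0 else 0)) (pdiff j p))) (at 0)"
          by (rule DERIV_cong, rule has_field_derivative_ev) (auto intro!: derivative_eq_intros)
        then have "((\<lambda>t. 0) has_field_derivative
          (\<Sum>j\<in>UNIV. (if j = i then 1 else 0) * ev x (pdiff j p))) (at 0)"
          using less.prems(1) by simp
        then have "(\<Sum>j\<in>UNIV. (if j = i then 1 else 0) * ev x (pdiff j p)) = 0"
          using DERIV_unique DERIV_const by blast
        moreover have "(\<Sum>j\<in>UNIV. (if j = i then 1 else 0) * ev x (pdiff j p))
          = (\<Sum>j\<in>UNIV. if j = i then ev x (pdiff j p) else 0)" by (intro sum.cong) auto
        ultimately show "ev x (pdiff i p) = 0" by simp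
      next
        fix m' assume "m' \<in> Poly_Mapping.keys (pdiff i p)"
        then have "m' + Poly_Mapping.single i 1 \<in> Poly_Mapping.keys p"
          by (auto simp: in_keys_iff lookup_pdiff)
        then have "mdeg (m' + Poly_Mapping.single i 1) \<le> D" by (rule less.prems)
        then show "mdeg m' \<le> D - 1"
          by (simp add: mdeg_def lookup_add sum.distrib lookup_single when_def)
      qed
      then have "Poly_Mapping.lookup (pdiff i p) ?m = 0" by simp
      then have "Poly_Mapping.lookup p m = 0" unfolding lookup_pdiff m' by (simp del: of_nat_Suc)
      then show False using m by (simp add: in_keys_iff)
    qed
    have "p = Const (Poly_Mapping.lookup p 0)"
    proof (rule poly_mapping_eqI)
      fix m show "Poly_Mapping.lookup p m = Poly_Mapping.lookup (Const (Poly_Mapping.lookup p 0)) m"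
        using key0[of m] by (auto simp: Const_def lookup_single in_keys_iff when_def)
    qed
    then show ?case using less.prems(1)[of undefined] ev_Const by (metis Const_0)
  qed
  from this[where D = "\<Sum>m\<in>Poly_Mapping.keys p. mdeg m", OF assms] show ?thesis
    by (meson finite_keys member_le_sum zero_le)
qed

lemma cpoly_eqI: "(\<And>x. ev x p = ev x q) \<Longrightarrow> p = q"
  using cpoly_eq_0I[of "p - q"] by simp

section \<open>Polynomials vanishing on grids\<close>

text \<open>Freezing all variables but \<open>i\<close> leaves a univariate polynomial. The bound
  \<open>B\<close> is strict, so there are \<open>B\<close> coefficients, and \<open>B\<close>
  distinct zeros force all of them to vanish.\<close>

lemma ev_fun_upd: 
  assumes "\<And>m. m \<in> Poly_Mapping.keys p \<Longrightarrow> Poly_Mapping.lookup m i < B"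
  shows "\<exists>c :: nat \<Rightarrow> complex. \<forall>y. ev (x(i := y)) p = (\<Sum>k<B. c k * y ^ k)"
proof -
  let ?l = "Poly_Mapping.lookup" and ?K = "Poly_Mapping.keys p"
  let ?t = "\<lambda>m. ?l p m * (\<Prod>j\<in>UNIV - {i}. x j ^ ?l m j)"
  define c where "c k = (\<Sum>m\<in>?K. if ?l m i = k then ?t m else 0)" for k
  have "ev (x(i := y)) p = (\<Sum>k<B. c k * y ^ k)" for y
  proof -
    have "(\<Prod>j\<in>UNIV. (x(i := y)) j ^ ?l m j) = y ^ ?l m i * (\<Prod>j\<in>UNIV - {i}. x j ^ ?l m j)" for m
      by (subst prod.remove[of _ i]) (auto intro!: prod.cong)
    then have "ev (x(i := y)) p = (\<Sum>m\<in>?K. ?t m * y ^ ?l m i)"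
      by (simp add: poly_eval_def mult_ac)
    also have "\<dots> = (\<Sum>m\<in>?K. \<Sum>k<B. if ?l m i = k then ?t m * y ^ k else 0)"
      using assms by (intro sum.cong) auto
    also have "\<dots> = (\<Sum>k<B. c k * y ^ k)"
      unfolding c_def sum_distrib_right by (subst sum.swap) (intro sum.cong, auto)
    finally show ?thesis .
  qed
  then show ?thesis by blast
qed

text \<open>A nonzero polynomial of degree at most \<open>B - 1\<close> has at most
  \<open>B - 1\<close> roots. Infinite sets are listed separately because \<open>card\<close> is 0
  for them.\<close>

lemma polynomial_many_roots:
  fixes c :: "nat \<Rightarrow> complex"
  assumes "infinite S \<or> B \<le> card S" "\<And>y. y \<in> S \<Longrightarrow> (\<Sum>k<B. c k * y ^ k) = 0" "k < B"
  shows "c k = 0"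
proof (rule ccontr)
  assume "c k \<noteq> 0"
  obtain n where B: "B = Suc n" using assms(3) by (cases B) auto
  let ?R = "{z. (\<Sum>i\<le>n. c i * z ^ i) = 0}"
  have R: "finite ?R" "card ?R \<le> n"
    using Poly_Roots.polyfun_rootbound[of n c] \<open>c k \<noteq> 0\<close> assms(3)
    unfolding B less_Suc_eq_le by blast+
  have "S \<subseteq> ?R" using assms(2) by (auto simp: B lessThan_Suc_atMost)
  then have "finite S" "card S \<le> n" using R finite_subset card_mono by (blast, meson le_trans)
  then show False using assms(1) by (simp add: B)
qed

text \<open>The restriction to the grid is lifted one coordinate at a time: if \<open>p\<close>
  vanishes whenever the coordinates outside \<open>I\<close> lie in the grid, the univariate root
  count in direction \<open>j\<close> frees \<open>j\<close> as well. The lemma serves both for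
  finite grids and for products of open sets.\<close>

lemma cpoly_eq_0_grid:
  fixes p :: "'v::finite cpoly"
  assumes big: "\<And>i. infinite (S i) \<or> B \<le> card (S i)"
    and deg: "\<And>m i. m \<in> Poly_Mapping.keys p \<Longrightarrow> Poly_Mapping.lookup m i < B"
    and zero: "\<And>x. (\<And>i. x i \<in> S i) \<Longrightarrow> ev x p = 0"
  shows "p = 0"
proof -
  have "\<forall>x. (\<forall>i. i \<notin> I \<longrightarrow> x i \<in> S i) \<longrightarrow> ev x p = 0" for I
    using finite[of I]
  proof (induction I rule: finite_induct)
    case empty
    then show ?case using zero by simp
  next
    case (insert j I)
    show ?case
    proof (intro allI impI)
      fix x :: "'v \<Rightarrow> complex" assume x: "\<forall>i. i \<notin> insert j I \<longrightarrow> x i \<in> S i"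
      obtain c where c: "\<And>y. ev (x(j := y)) p = (\<Sum>k<B. c k * y ^ k)"
        using ev_fun_upd[of p j B x] deg by blast
      have "(\<Sum>k<B. c k * y ^ k) = 0" if "y \<in> S j" for y
        unfolding c[symmetric] using that x insert.IH by simp
      then have "\<And>k. k < B \<Longrightarrow> c k = 0" using polynomial_many_roots[OF big] by blast
      then have "ev (x(j := x j)) p = 0" unfolding c by simp
      then show "ev x p = 0" by simp
    qed
  qed
  from this[of UNIV] show ?thesis by (intro cpoly_eq_0I) simp
qed


section \<open>Forms, cones and linear syzygies\<close>

lemma forms_0 [simp]: "0 \<in> forms k"
  by (simp add: forms_def)

lemma forms_add: "p \<in> forms k \<Longrightarrow> q \<in> forms k \<Longrightarrow> p + q \<in> forms k"
  using Poly_Mapping.keys_add[of p q] by (auto simp: forms_def)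

lemma forms_uminus: "p \<in> forms k \<Longrightarrow> - p \<in> forms k"
  by (simp add: forms_def)

lemma forms_sum: "(\<And>a. a \<in> A \<Longrightarrow> p a \<in> forms k) \<Longrightarrow> (\<Sum>a\<in>A. p a) \<in> forms k"
  by (induction A rule: infinite_finite_induct) (simp_all add: forms_add)

lemma forms_Const [simp]: "Const c \<in> forms 0"
  by (simp add: forms_def Const_def mdeg_def)

lemma forms_Const_mult: "p \<in> forms k \<Longrightarrow> Const c * p \<in> forms k"
  using forms_mult[of "Const c" 0 p k] by simp

lemma forms_Var [simp]: "Var i \<in> forms 1"
  by (simp add: forms_def Var_def mdeg_def lookup_single when_def)

lemma forms_0_eq: "p \<in> forms 0 \<Longrightarrow> p = Const (Poly_Mapping.lookup p 0)"
proof (rule poly_mapping_eqI)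
  fix m assume p: "p \<in> forms 0"
  have "Poly_Mapping.lookup p m = 0" if "m \<noteq> 0"
  proof (rule ccontr)
    assume "Poly_Mapping.lookup p m \<noteq> 0"
    then have "mdeg m = 0" using p by (simp add: forms_def in_keys_iff)
    then have "m = 0" by (intro poly_mapping_eqI) (simp add: mdeg_def)
    then show False using that by simp
  qed
  then show "Poly_Mapping.lookup p m = Poly_Mapping.lookup (Const (Poly_Mapping.lookup p 0)) m"
    by (auto simp: Const_def lookup_single when_def)
qed

lemma mdeg_1_eq: 
  assumes "mdeg m = 1" shows "\<exists>j. m = Poly_Mapping.single j 1"
proof -
  obtain j where j: "Poly_Mapping.lookup m j \<noteq> 0"
    using assms by (force simp: mdeg_def)
  have s: "mdeg m = Poly_Mapping.lookup m j + (\<Sum>i\<in>UNIV - {j}. Poly_Mapping.lookup m i)"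
    unfolding mdeg_def by (rule sum.remove) auto
  then have "(\<Sum>i\<in>UNIV - {j}. Poly_Mapping.lookup m i) = 0" "Poly_Mapping.lookup m j = 1"
    using j assms by linarith+
  then have "m = Poly_Mapping.single j 1"
    by (intro poly_mapping_eqI) (auto simp: lookup_single when_def)
  then show ?thesis ..
qed

lemma forms_1_eq: 
  assumes "p \<in> forms 1"
  shows "p = (\<Sum>j\<in>UNIV. Const (Poly_Mapping.lookup p (Poly_Mapping.single j 1)) * Var j)"
proof (rule poly_mapping_eqI)
  fix m
  have R: "Poly_Mapping.lookup (\<Sum>j\<in>UNIV. Const (Poly_Mapping.lookup p (Poly_Mapping.single j 1)) * Var j) m
    = (\<Sum>j\<in>UNIV. Poly_Mapping.lookup p (Poly_Mapping.single j 1) * (1 when Poly_Mapping.single j 1 = m))"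
    by (simp add: lookup_sum lookup_Const_mult Var_def lookup_single)
  show "Poly_Mapping.lookup p m = Poly_Mapping.lookup
    (\<Sum>j\<in>UNIV. Const (Poly_Mapping.lookup p (Poly_Mapping.single j 1)) * Var j) m"
  proof (cases "\<exists>j. m = Poly_Mapping.single j 1")
    case True
    then obtain j where m: "m = Poly_Mapping.single j 1" by blast
    have "Poly_Mapping.single k (1::nat) = Poly_Mapping.single j 1 \<longleftrightarrow> k = j" for k :: 'a
      by (metis lookup_single_eq lookup_single_not_eq one_neq_zero)
    then show ?thesis unfolding R unfolding m by (simp only: when_def) (simp add: if_distrib[where f = "\<lambda>x. _ * x"] cong: if_cong)
  next
    case False
    then have "m \<notin> Poly_Mapping.keys p" using assms mdeg_1_eq by (auto simp: forms_def)
    moreover have "Poly_Mapping.single j 1 \<noteq> m" for j using False by auto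
    ultimately show ?thesis unfolding R by (simp add: in_keys_iff)
  qed
qed

lemma ev_poly_eval_Const: "ev x (poly_eval Const X f) = ev (\<lambda>i. ev x (X i)) f"
  unfolding poly_eval_def[of Const] by (simp add: ev_simps) (simp add: poly_eval_def)

lemma vec_nth_lambda [simp]: "($) (\<chi> i. x i) = x"
  by (simp add: fun_eq_iff)

lemma ev_compose_linear: "ev (($) v) (compose_linear f g) = ev (($) (g *v v)) f"
  unfolding compose_linear_def ev_poly_eval_Const
  by (simp add: ev_simps matrix_vector_mult_def)

lemma ev_scale:
  assumes "p \<in> forms k" shows "ev (\<lambda>i. c * x i) p = c ^ k * ev x p"
proof -
  have "(\<Prod>i\<in>UNIV. (c * x i) ^ Poly_Mapping.lookup m i)
      = c ^ k * (\<Prod>i\<in>UNIV. x i ^ Poly_Mapping.lookup m i)"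
    if "m \<in> Poly_Mapping.keys p" for m
    using that assms
    by (simp add: forms_def mdeg_def power_mult_distrib prod.distrib power_sum[symmetric])
  then show ?thesis
    by (simp add: poly_eval_def sum_distrib_left mult_ac cong: sum.cong)
qed

lemma vec_cpoly_eqI:
  fixes p :: "'n::finite cpoly"
  assumes "\<And>v. ev (($) v) p = ev (($) v) q" shows "p = q"
proof (rule cpoly_eqI)
  fix x :: "'n \<Rightarrow> complex"
  show "ev x p = ev x q" using assms[of "\<chi> i. x i"] by simp
qed

lemma euler:
  assumes "p \<in> forms k"
  shows "(\<Sum>i\<in>UNIV. x i * ev x (pdiff i p)) = of_nat k * ev x p"
proof -
  have 1: "((\<lambda>t. ev (\<lambda>i. t * x i) p) has_field_derivative
      (\<Sum>i\<in>UNIV. x i * ev (\<lambda>i. 1 * x i) (pdiff i p))) (at 1)"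
    by (rule has_field_derivative_ev) (auto intro!: derivative_eq_intros)
  have "((\<lambda>t. t ^ k * ev x p) has_field_derivative of_nat k * ev x p) (at 1)"
    by (auto intro!: derivative_eq_intros)
  with 1 show ?thesis unfolding ev_scale[OF assms] using DERIV_unique by fastforce
qed

section \<open>Infinitesimal symmetries, cones and syzygies of degree at most 1\<close>

text \<open>The sum is the derivative of \<open>f\<close> at \<open>v\<close> in the direction
  \<open>B v\<close>, so these matrices form the Lie algebra of the linear stabilizer of
  \<open>f\<close>. The pointwise form fits computations with derivatives;
  \<open>infinitesimal_symmetry_iff\<close> turns it into a linear relation among the forms
  \<open>x_j f_i\<close>.\<close>

definition infinitesimal_symmetry :: "'n::finite cpoly \<Rightarrow> complex^'n^'n \<Rightarrow> bool"
  where "infinitesimal_symmetry f B \<longleftrightarrow>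
    (\<forall>v. (\<Sum>i\<in>UNIV. (B *v v) $ i * ev (($) v) (pdiff i f)) = 0)"

lemma infinitesimal_symmetry_iff:
  "infinitesimal_symmetry f B \<longleftrightarrow>
    (\<Sum>i\<in>UNIV. \<Sum>j\<in>UNIV. Const (B $ i $ j) * (Var j * pdiff i f)) = 0" (is "_ \<longleftrightarrow> ?p = 0")
proof -
  have "(\<Sum>i\<in>UNIV. (B *v v) $ i * ev (($) v) (pdiff i f)) = ev (($) v) ?p" for v
    by (simp add: ev_simps matrix_vector_mult_def sum_distrib_left sum_distrib_right mult_ac)
  then show ?thesis unfolding infinitesimal_symmetry_def
    using vec_cpoly_eqI[of ?p 0] by auto
qed

lemma ex_infinitesimal_symmetry_iff:
  "(\<exists>B. B \<noteq> 0 \<and> infinitesimal_symmetry f B) \<longleftrightarrow>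
    (\<exists>c. (\<exists>i j. c i j \<noteq> 0) \<and> (\<Sum>i\<in>UNIV. \<Sum>j\<in>UNIV. Const (c i j) * (Var j * pdiff i f)) = 0)"
  (is "?L \<longleftrightarrow> ?R")
proof
  assume ?L
  then obtain B where "B \<noteq> 0" "infinitesimal_symmetry f B" by blast
  then show ?R
    by (intro exI[of _ "\<lambda>i j. B $ i $ j"]) (auto simp: infinitesimal_symmetry_iff vec_eq_iff)
next
  assume ?R
  then obtain c where "\<exists>i j. c i j \<noteq> 0"
    "(\<Sum>i\<in>UNIV. \<Sum>j\<in>UNIV. Const (c i j) * (Var j * pdiff i f)) = 0" by blast
  then show ?L
    by (intro exI[of _ "\<chi> i j. c i j"]) (auto simp: infinitesimal_symmetry_iff vec_eq_iff)
qed

text \<open>A constant syzygy \<open>u\<close> means that the derivative of \<open>f\<close> in the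
  direction \<open>u\<close> is 0. In coordinates where \<open>u\<close> is the \<open>k\<close>-th
  basis vector this is a partial derivative, and in characteristic 0 its vanishing removes the
  variable \<open>k\<close>.\<close>

lemma is_coneI:
  fixes f :: "'n::finite cpoly"
  assumes u: "u k \<noteq> 0" and syz: "(\<Sum>i\<in>UNIV. Const (u i) * pdiff i f) = 0"
  shows "is_cone f"
proof -
  \<comment> \<open>The identity matrix with its \<open>k\<close>-th column replaced by
    \<open>u\<close>; it is injective because \<open>u k\<close> is not 0.\<close>
  define g :: "complex^'n^'n" where "g = (\<chi> i j. if j = k then u i else if i = j then 1 else 0)"
  have gv: "(g *v v) $ i = u i * v $ k + (if i = k then 0 else v $ i)" for v i
  proof -
    have "(g *v v) $ i = (\<Sum>j\<in>UNIV. g $ i $ j * v $ j)" by (simp add: matrix_vector_mult_def)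
    also have "\<dots> = g $ i $ k * v $ k + (\<Sum>j\<in>UNIV - {k}. g $ i $ j * v $ j)"
      by (rule sum.remove) auto
    also have "(\<Sum>j\<in>UNIV - {k}. g $ i $ j * v $ j) = (\<Sum>j\<in>UNIV - {k}. if j = i then v $ i else 0)"
      by (intro sum.cong) (auto simp: g_def)
    finally show ?thesis by (simp add: g_def)
  qed
  have "v = 0" if v: "g *v v = 0" for v
  proof -
    have "v $ k = 0" using gv[of v k] u v by simp
    then have "v $ i = 0" for i using gv[of v i] v by (cases "i = k") simp_all
    then show ?thesis by (simp add: vec_eq_iff)
  qed
  then have g: "invertible g"
    using invertible_left_inverse[of g] matrix_left_invertible_ker[of g] by blast
  let ?h = "compose_linear f g"
  have "pdiff k ?h = 0"
  proof (rule vec_cpoly_eqI)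
    fix v :: "complex^'n"
    have u0: "(\<Sum>i\<in>UNIV. u i * ev x (pdiff i f)) = 0" for x
      using arg_cong[OF syz, of "ev x"] by (simp add: ev_simps)
    \<comment> \<open>The line through \<open>v\<close> parallel to the \<open>k\<close>-th axis.
      Its image under \<open>g\<close> is a line in the direction \<open>u\<close>, along which
      \<open>f\<close> has derivative 0.\<close>
    define X where "X t = (\<chi> i. v $ i + (if i = k then t else 0))" for t :: complex
    have X0: "X 0 = v" by (simp add: X_def vec_eq_iff)
    have gX: "(g *v X t) $ i = u i * (v $ k + t) + (if i = k then 0 else v $ i)" for t i
      unfolding gv by (simp add: X_def)
    have 1: "((\<lambda>t. ev (($) (X t)) ?h) has_field_derivative
      (\<Sum>i\<in>UNIV. (if i = k then 1 else 0) * ev (($) (X 0)) (pdiff i ?h))) (at 0)"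
      by (rule has_field_derivative_ev) (auto simp: X_def intro!: derivative_eq_intros)
    have 2: "((\<lambda>t. ev (($) (g *v X t)) f) has_field_derivative
      (\<Sum>i\<in>UNIV. u i * ev (($) (g *v X 0)) (pdiff i f))) (at 0)"
      by (rule has_field_derivative_ev) (auto simp: gX intro!: derivative_eq_intros)
    have "(\<Sum>i\<in>UNIV. (if i = k then 1 else 0) * ev (($) v) (pdiff i ?h)) = 0"
      using DERIV_unique[OF 1[unfolded ev_compose_linear] 2] unfolding u0 X0 .
    moreover have "(\<Sum>i\<in>UNIV. (if i = k then 1 else 0) * ev (($) v) (pdiff i ?h))
      = (\<Sum>i\<in>UNIV. if i = k then ev (($) v) (pdiff i ?h) else 0)" by (intro sum.cong) auto
    ultimately show "ev (($) v) (pdiff k ?h) = ev (($) v) 0" by simp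
  qed
  then have *: "Poly_Mapping.lookup ?h (m + Poly_Mapping.single k 1) = 0" for m
    using lookup_pdiff[of k ?h m] by (simp del: of_nat_Suc)
  have "Poly_Mapping.lookup m k = 0" if m: "m \<in> Poly_Mapping.keys ?h" for m
  proof (rule ccontr)
    assume "Poly_Mapping.lookup m k \<noteq> 0"
    then have "m - Poly_Mapping.single k 1 + Poly_Mapping.single k 1 = m"
      by (intro poly_mapping_eqI) (auto simp: lookup_add lookup_minus lookup_single when_def)
    then show False using *[of "m - Poly_Mapping.single k 1"] m by (simp add: in_keys_iff)
  qed
  then show ?thesis unfolding is_cone_def using g by blast
qed

lemma pdiff_nonzero: 
  assumes "\<not> is_cone f" shows "pdiff i f \<noteq> 0"
proof
  assume "pdiff i f = 0"
  then have "Const (if j = i then 1 else 0) * pdiff j f = 0" for j by simp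
  then have "(\<Sum>j\<in>UNIV. Const (if j = i then 1 else 0) * pdiff j f) = 0" by (simp only: sum.neutral_const)
  then show False using is_coneI[of "\<lambda>j. if j = i then 1 else 0" i f] assms by simp
qed

text \<open>Constant syzygies would make \<open>f\<close> a cone, and a syzygy with linear entries
  is a matrix \<open>B\<close>. Hence 1 is the first possible degree, and it is attained exactly
  when there is a nonzero infinitesimal symmetry.\<close>

lemma indeg_Syz_eq_1_iff:
  fixes f :: "'n::finite cpoly"
  assumes f: "f \<in> forms (Suc k)" and nc: "\<not> is_cone f" and card: "CARD('n) \<ge> 2"
  shows "indeg (Syz f) = 1 \<longleftrightarrow> (\<exists>B. B \<noteq> 0 \<and> infinitesimal_symmetry f B)"
proof -
  let ?D = "\<lambda>k. {a :: 'n cpoly ^ 'n. \<forall>i. a $ i \<in> forms k}"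
  let ?P = "\<lambda>k. Syz f \<inter> ?D k \<noteq> {0}"
  have P: "?P k \<longleftrightarrow> (\<exists>a. a \<noteq> 0 \<and> a \<in> Syz f \<and> (\<forall>i. a $ i \<in> forms k))" for k
  proof -
    have "0 \<in> Syz f \<inter> ?D k" by (simp add: Syz_def)
    then show ?thesis by blast
  qed
  have P0: "\<not> ?P 0"
  proof
    assume "?P 0"
    then obtain a where a: "a \<noteq> 0" "a \<in> Syz f" "\<And>i. a $ i \<in> forms 0" unfolding P by blast
    define u where "u i = Poly_Mapping.lookup (a $ i) 0" for i
    have u: "a $ i = Const (u i)" for i using forms_0_eq[OF a(3)] by (simp add: u_def)
    obtain j where "a $ j \<noteq> 0" using a(1) by (auto simp: vec_eq_iff)
    then have "u j \<noteq> 0" unfolding u by auto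
    moreover have "(\<Sum>i\<in>UNIV. Const (u i) * pdiff i f) = 0"
      using a(2) by (simp add: Syz_def u)
    ultimately show False using is_coneI nc by blast
  qed
  have P1: "?P 1 \<longleftrightarrow> (\<exists>B. B \<noteq> 0 \<and> infinitesimal_symmetry f B)"
  proof
    assume "?P 1"
    then obtain a where a: "a \<noteq> 0" "a \<in> Syz f" "\<And>i. a $ i \<in> forms 1" unfolding P by blast
    define B where "B = (\<chi> i j. Poly_Mapping.lookup (a $ i) (Poly_Mapping.single j 1))"
    have B: "a $ i = (\<Sum>j\<in>UNIV. Const (B $ i $ j) * Var j)" for i
      using forms_1_eq[OF a(3)] by (simp add: B_def)
    have "B \<noteq> 0"
    proof
      assume "B = 0"
      then have "a $ i = 0" for i unfolding B by simp
      then show False using a(1) by (simp add: vec_eq_iff)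
    qed
    moreover have "infinitesimal_symmetry f B"
    proof -
      have "(\<Sum>i\<in>UNIV. a $ i * pdiff i f) = 0" using a(2) by (simp add: Syz_def)
      then show ?thesis unfolding infinitesimal_symmetry_iff B
        by (simp add: sum_distrib_left sum_distrib_right mult_ac)
    qed
    ultimately show "\<exists>B. B \<noteq> 0 \<and> infinitesimal_symmetry f B" by blast
  next
    assume "\<exists>B. B \<noteq> 0 \<and> infinitesimal_symmetry f B"
    then obtain B where B: "B \<noteq> 0" "infinitesimal_symmetry f B" by blast
    define a where "a = (\<chi> i. \<Sum>j\<in>UNIV. Const (B $ i $ j) * Var j)"
    have "a \<in> Syz f"
      using B(2) unfolding infinitesimal_symmetry_iff Syz_def a_def
      by (simp add: sum_distrib_left sum_distrib_right mult_ac)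
    moreover have "a $ i \<in> forms 1" for i
      unfolding a_def vec_lambda_beta by (intro forms_sum forms_Const_mult forms_Var)
    moreover have "a \<noteq> 0"
    proof
      assume a0: "a = 0"
      have "B *v v = 0" for v
      proof -
        have "(B *v v) $ i = ev (($) v) (a $ i)" for i
          by (simp add: a_def ev_simps matrix_vector_mult_def)
        then show ?thesis by (simp add: a0 vec_eq_iff)
      qed
      then show False using B(1) by (metis matrix_eq matrix_vector_mult_0)
    qed
    ultimately show "?P 1" unfolding P by blast
  qed
  \<comment> \<open>\<open>LEAST\<close> returns a degree with the property only if there is one.
    The Koszul relation between two distinct partials, which have degree \<open>k\<close>, provides
    it; it is nonzero because no partial of a non-cone vanishes.\<close>
  have ex: "?P k"
  proof -
    obtain i j :: 'n where ij: "i \<noteq> j"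
      using card card_le_Suc0_iff_eq[of "UNIV :: 'n set"] by fastforce
    define a :: "'n cpoly ^ 'n"
      where "a = (\<chi> l. if l = i then pdiff j f else if l = j then - pdiff i f else 0)"
    have "(\<Sum>l\<in>UNIV. a $ l * pdiff l f) = a $ i * pdiff i f + (a $ j * pdiff j f
        + (\<Sum>l\<in>UNIV - {i} - {j}. a $ l * pdiff l f))"
      using ij by (simp add: sum.remove[of UNIV i] sum.remove[of "UNIV - {i}" j])
    also have "(\<Sum>l\<in>UNIV - {i} - {j}. a $ l * pdiff l f) = 0"
      by (intro sum.neutral) (auto simp: a_def)
    finally have "a \<in> Syz f" using ij by (simp add: Syz_def a_def mult_ac)
    moreover have "a $ l \<in> forms k" for l
      using pdiff_forms[OF f] by (simp add: a_def forms_uminus)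
    moreover have "a \<noteq> 0"
    proof
      assume "a = 0"
      then have "a $ i = 0" by simp
      then show False using pdiff_nonzero[OF nc, of j] by (simp add: a_def)
    qed
    ultimately show ?thesis unfolding P by blast
  qed
  have L: "indeg (Syz f) = (LEAST k. ?P k)" by (simp add: indeg_def)
  show ?thesis
  proof
    assume "indeg (Syz f) = 1"
    then have "?P 1" using LeastI[of ?P, OF ex] unfolding L by simp
    then show "\<exists>B. B \<noteq> 0 \<and> infinitesimal_symmetry f B" unfolding P1 .
  next
    assume "\<exists>B. B \<noteq> 0 \<and> infinitesimal_symmetry f B"
    then have "?P 1" unfolding P1 .
    then show "indeg (Syz f) = 1" unfolding L
    proof (rule Least_equality)
      fix y assume "?P y"
      then show "1 \<le> y" using P0 by (cases y) auto
    qed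
  qed
qed


section \<open>Finiteness of the stabilizer\<close>

text \<open>Gaussian elimination, one equation per step: either equation \<open>m\<close> is
  vacuous, or some unknown \<open>a0\<close> occurs in it and can be eliminated from the other
  equations, which costs one equation and one unknown.\<close>

lemma nontrivial_solution:
  fixes c :: "'a \<Rightarrow> 'b \<Rightarrow> complex"
  assumes "finite M" "finite A" "card M < card A"
  shows "\<exists>u. (\<exists>a\<in>A. u a \<noteq> 0) \<and> (\<forall>m\<in>M. (\<Sum>a\<in>A. u a * c a m) = 0)"
  using assms
proof (induction M arbitrary: A c rule: finite_induct)
  case empty
  then have "A \<noteq> {}" by auto
  then show ?case by (intro exI[of _ "\<lambda>_. 1"]) auto
next
  case (insert m M)
  show ?case
  proof (cases "\<forall>a\<in>A. c a m = 0")
    case True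
    obtain u where "\<exists>a\<in>A. u a \<noteq> 0" "\<forall>m\<in>M. (\<Sum>a\<in>A. u a * c a m) = 0"
      using insert.IH[of A c] insert.prems insert.hyps by force
    then show ?thesis using True by (intro exI[of _ u]) auto
  next
    case False
    then obtain a0 where a0: "a0 \<in> A" "c a0 m \<noteq> 0" by blast
    let ?A = "A - {a0}"
    let ?c = "\<lambda>a k. c a k - c a m / c a0 m * c a0 k"
    have "card M < card ?A" using insert a0 by (simp add: card_Diff_singleton)
    then obtain u where u: "\<exists>a\<in>?A. u a \<noteq> 0" "\<forall>k\<in>M. (\<Sum>a\<in>?A. u a * ?c a k) = 0"
      using insert.IH[of ?A ?c] insert.prems by blast
    \<comment> \<open>The pivot unknown \<open>a0\<close> receives the value that solves equation
      \<open>m\<close>; inserting it into equation \<open>k\<close> produces the reduced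
      coefficients \<open>?c\<close>.\<close>
    define w where "w a = (if a = a0 then - (\<Sum>b\<in>?A. u b * c b m / c a0 m) else u a)" for a
    have w: "(\<Sum>a\<in>A. w a * c a k) = (\<Sum>a\<in>?A. u a * ?c a k)" for k
    proof -
      have *: "w a0 * c a0 k = - (\<Sum>a\<in>?A. u a * (c a m / c a0 m * c a0 k))"
        by (simp add: w_def sum_distrib_left sum_distrib_right mult_ac)
      have "(\<Sum>a\<in>A. w a * c a k) = w a0 * c a0 k + (\<Sum>a\<in>?A. w a * c a k)"
        using insert.prems a0 by (intro sum.remove) auto
      also have "(\<Sum>a\<in>?A. w a * c a k) = (\<Sum>a\<in>?A. u a * c a k)"
        by (intro sum.cong) (auto simp: w_def)
      finally show ?thesis
        unfolding * by (simp add: right_diff_distrib sum_subtractf)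
    qed
    have "(\<Sum>a\<in>A. w a * c a m) = 0" unfolding w using a0 by simp
    moreover have "\<forall>k\<in>M. (\<Sum>a\<in>A. w a * c a k) = 0" unfolding w by (rule u(2))
    moreover have "\<exists>a\<in>A. w a \<noteq> 0" using u(1) by (auto simp: w_def)
    ultimately show ?thesis by (intro exI[of _ w]) auto
  qed
qed

lemma finite_vec_box:
  fixes T :: "'n::finite \<Rightarrow> 'a set"
  assumes "\<And>i. finite (T i)" shows "finite {x :: 'a^'n. \<forall>i. x $ i \<in> T i}"
proof (rule finite_subset)
  show "{x :: 'a^'n. \<forall>i. x $ i \<in> T i} \<subseteq> vec_lambda ` (PiE UNIV T)"
  proof
    fix x :: "'a^'n" assume "x \<in> {x. \<forall>i. x $ i \<in> T i}"
    then have "($) x \<in> PiE UNIV T" by auto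
    then show "x \<in> vec_lambda ` (PiE UNIV T)"
      by (rule rev_image_eqI) simp
  qed
  show "finite (vec_lambda ` (PiE UNIV T) :: ('a^'n) set)"
    using assms by (intro finite_imageI finite_PiE) auto
qed

text \<open>Bounding every exponent separately, rather than the total degree, gives a box whose
  cardinality is an exact power of \<open>B\<close>.\<close>

definition expo_box :: "nat \<Rightarrow> ('v::finite \<Rightarrow>\<^sub>0 nat) set"
  where "expo_box B = {m. \<forall>i. Poly_Mapping.lookup m i < B}"

lemma bij_betw_lookup_expo_box:
  "bij_betw Poly_Mapping.lookup (expo_box B :: ('v::finite \<Rightarrow>\<^sub>0 nat) set) (PiE UNIV (\<lambda>_. {..<B}))"
proof (rule bij_betwI')
  fix y :: "'v \<Rightarrow> nat" assume "y \<in> PiE UNIV (\<lambda>_. {..<B})"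
  moreover have "Poly_Mapping.lookup (Abs_poly_mapping y) = y"
    by (rule lookup_Abs_poly_mapping) simp
  ultimately show "\<exists>x\<in>expo_box B. y = Poly_Mapping.lookup x"
    by (intro bexI[of _ "Abs_poly_mapping y"]) (auto simp: expo_box_def)
qed (auto simp: expo_box_def lookup_inject PiE_def)

lemma finite_expo_box [simp]: "finite (expo_box B)"
  using bij_betw_finite[OF bij_betw_lookup_expo_box] by (simp add: finite_PiE)

lemma card_expo_box: "card (expo_box B :: ('v::finite \<Rightarrow>\<^sub>0 nat) set) = B ^ CARD('v)"
  using bij_betw_same_card[OF bij_betw_lookup_expo_box, of B] by (simp add: card_PiE)

definition expo_le :: "nat \<Rightarrow> 'v::finite cpoly \<Rightarrow> bool"
  where "expo_le D p \<longleftrightarrow> (\<forall>m\<in>Poly_Mapping.keys p. \<forall>i. Poly_Mapping.lookup m i \<le> D)"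

lemma expo_le_mono: "expo_le D p \<Longrightarrow> D \<le> E \<Longrightarrow> expo_le E p"
  unfolding expo_le_def using le_trans by blast

lemma expo_le_1 [simp]: "expo_le D 1"
  by (simp add: expo_le_def)

lemma expo_le_mult: "expo_le D p \<Longrightarrow> expo_le E q \<Longrightarrow> expo_le (D + E) (p * q)"
  unfolding expo_le_def using keys_mult[of p q] by (fastforce simp: lookup_add intro: add_mono)

lemma expo_le_power: "expo_le D p \<Longrightarrow> expo_le (k * D) (p ^ k)"
  by (induction k) (simp_all add: expo_le_mult)

lemma expo_le_prod: "(\<And>a. a \<in> A \<Longrightarrow> expo_le (D a) (p a)) \<Longrightarrow> expo_le (\<Sum>a\<in>A. D a) (\<Prod>a\<in>A. p a)"
  by (induction A rule: infinite_finite_induct) (simp_all add: expo_le_mult)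

lemma ex_expo_le: "\<exists>D. expo_le D p"
proof
  have "Poly_Mapping.lookup m i \<le> (\<Sum>m\<in>Poly_Mapping.keys p. mdeg m)"
    if "m \<in> Poly_Mapping.keys p" for m i
  proof -
    have "Poly_Mapping.lookup m i \<le> mdeg m"
      unfolding mdeg_def by (rule member_le_sum) auto
    also have "\<dots> \<le> (\<Sum>m\<in>Poly_Mapping.keys p. mdeg m)"
      using that by (intro member_le_sum) auto
    finally show ?thesis .
  qed
  then show "expo_le (\<Sum>m\<in>Poly_Mapping.keys p. mdeg m) p"
    by (auto simp: expo_le_def)
qed

text \<open>Counting: with \<open>N\<close> variables there are \<open>B ^ (N + 1)\<close> products with exponents below \<open>B\<close>, while the
  number of monomials they can involve is the \<open>N\<close>-th power of a number linear in \<open>B\<close>.\<close>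

lemma algebraic_dependence:
  fixes G :: "'v::finite \<Rightarrow> 'v cpoly" and L :: "'v cpoly"
  shows "\<exists>B c. (\<exists>a<B. \<exists>m\<in>expo_box B. c a m \<noteq> 0) \<and>
    (\<Sum>a<B. \<Sum>m\<in>expo_box B. Const (c a m) * (L ^ a * (\<Prod>i\<in>UNIV. G i ^ Poly_Mapping.lookup m i))) = 0"
proof -
  let ?N = "CARD('v)"
  obtain DL where DL: "expo_le DL L" using ex_expo_le by blast
  obtain DG where DG: "\<And>i. expo_le (DG i) (G i)" using ex_expo_le[of "G _"] by metis
  define D where "D = DL + (\<Sum>i\<in>UNIV. DG i)"
  have L: "expo_le D L" by (rule expo_le_mono[OF DL]) (simp add: D_def)
  have G: "expo_le D (G i)" for i
    by (rule expo_le_mono[OF DG]) (simp add: D_def member_le_sum trans_le_add2)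
  \<comment> \<open>\<open>M\<close> bounds the exponents in all products \<open>p am\<close>. The
    choice of \<open>Q\<close> gives \<open>M + 1 <= B * Q\<close>, and \<open>B\<close> exceeds
    \<open>Q ^ ?N\<close>, so the \<open>(M + 1) ^ ?N\<close> possible monomials are fewer than the
    \<open>B ^ ?N * B\<close> products.\<close>
  define Q where "Q = D * (?N + 1) + 1"
  define B where "B = Q ^ ?N + 1"
  define M where "M = B * D * (?N + 1)"
  define p where "p am = L ^ fst am * (\<Prod>i\<in>UNIV. G i ^ Poly_Mapping.lookup (snd am) i)"
    for am :: "nat \<times> ('v \<Rightarrow>\<^sub>0 nat)"
  let ?A = "{..<B} \<times> (expo_box B :: ('v \<Rightarrow>\<^sub>0 nat) set)"
  have p: "expo_le M (p am)" if "am \<in> ?A" for am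
  proof -
    obtain a m where am: "am = (a, m)" "a < B" "\<And>i. Poly_Mapping.lookup m i < B"
      using \<open>am \<in> ?A\<close> by (auto simp: expo_box_def)
    have "expo_le (a * D + (\<Sum>i\<in>UNIV. Poly_Mapping.lookup m i * D)) (p am)"
      unfolding p_def am(1) fst_conv snd_conv
      by (intro expo_le_mult expo_le_power expo_le_prod L G)
    moreover have "a * D + (\<Sum>i\<in>UNIV. Poly_Mapping.lookup m i * D) \<le> B * D + (\<Sum>i\<in>(UNIV::'v set). B * D)"
      using am(2,3) by (intro add_mono sum_mono mult_right_mono) (auto simp: less_imp_le)
    moreover have "B * D + (\<Sum>i\<in>(UNIV::'v set). B * D) = M" by (simp add: M_def algebra_simps)
    ultimately show ?thesis using expo_le_mono by metis
  qed
  have "card (expo_box (M + 1) :: ('v \<Rightarrow>\<^sub>0 nat) set) = (M + 1) ^ ?N" by (rule card_expo_box)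
  also have "\<dots> \<le> (B * Q) ^ ?N"
    by (intro power_mono) (auto simp: M_def Q_def algebra_simps B_def)
  also have "\<dots> < B ^ ?N * B"
    unfolding power_mult_distrib by (rule mult_strict_left_mono) (simp_all add: B_def)
  also have "\<dots> = card ?A" by (simp add: card_expo_box)
  finally have "card (expo_box (M + 1) :: ('v \<Rightarrow>\<^sub>0 nat) set) < card ?A" .
  then obtain u where u: "\<exists>am\<in>?A. u am \<noteq> 0"
    "\<forall>k\<in>expo_box (M + 1). (\<Sum>am\<in>?A. u am * Poly_Mapping.lookup (p am) k) = 0"
    using nontrivial_solution[of "expo_box (M + 1)" ?A "\<lambda>am. Poly_Mapping.lookup (p am)"] by auto
  have "(\<Sum>am\<in>?A. Const (u am) * p am) = 0"
  proof (rule poly_mapping_eqI)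
    fix k
    have "(\<Sum>am\<in>?A. u am * Poly_Mapping.lookup (p am) k) = 0"
    proof (cases "k \<in> expo_box (M + 1)")
      case False
      have "Poly_Mapping.lookup (p am) k = 0" if "am \<in> ?A" for am
        using p[OF that] False unfolding expo_le_def expo_box_def
        by (auto simp: in_keys_iff less_Suc_eq_le)
      then show ?thesis by simp
    qed (use u in blast)
    then show "Poly_Mapping.lookup (\<Sum>am\<in>?A. Const (u am) * p am) k = Poly_Mapping.lookup 0 k"
      by (simp add: lookup_sum lookup_Const_mult)
  qed
  then have "(\<Sum>a<B. \<Sum>m\<in>expo_box B. Const (u (a, m)) * p (a, m)) = 0"
    by (simp add: sum.cartesian_product)
  then show ?thesis
    using u(1) unfolding p_def
    by (intro exI[of _ B] exI[of _ "\<lambda>a m. u (a, m)"]) auto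
qed

section \<open>Nondegenerate solutions of square polynomial systems\<close>

lemma has_derivative_vec_lambda:
  fixes f :: "'a::real_normed_vector \<Rightarrow> 'n::finite \<Rightarrow> complex"
  assumes "\<And>i. ((\<lambda>x. f x i) has_derivative (\<lambda>y. f' y i)) (at a)"
  shows "((\<lambda>x. \<chi> i. f x i) has_derivative (\<lambda>y. \<chi> i. f' y i)) (at a)"
  unfolding has_derivative_componentwise_within[of "\<lambda>x. \<chi> i. f x i"]
proof
  fix b :: "complex^'n" assume "b \<in> Basis"
  then obtain i u where "b = axis i u" by (auto simp: Basis_vec_def)
  then show "((\<lambda>x. (\<chi> i. f x i) \<bullet> b) has_derivative (\<lambda>x. (\<chi> i. f' x i) \<bullet> b)) (at a)"
    using assms[of i] by (simp add: inner_axis has_derivative_inner_left)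
qed

text \<open>It suffices that each coordinate \<open>k\<close> takes finitely many values. Otherwise
  there are \<open>B\<close> solutions with distinct \<open>k\<close>-th coordinates; they persist
  in all nearby fibers, and a suitable nearby fiber forces their coordinates to be roots of a
  nonzero polynomial with only \<open>B\<close> coefficients.\<close>

lemma finite_nondegenerate_fiber:
  fixes G :: "'v::finite \<Rightarrow> 'v cpoly" and b :: "'v \<Rightarrow> complex"
  shows "finite {x :: complex^'v. (\<forall>i. ev (($) x) (G i) = b i) \<and>
    (\<forall>y. (\<forall>i. (\<Sum>j\<in>UNIV. y $ j * ev (($) x) (pdiff j (G i))) = 0) \<longrightarrow> y = 0)}" (is "finite ?S")
proof -
  define F where "F x = (\<chi> i. ev (($) x) (G i))" for x :: "complex^'v"
  define F' where "F' x y = (\<chi> i. \<Sum>j\<in>UNIV. y $ j * ev (($) x) (pdiff j (G i)))" for x y :: "complex^'v"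
  have F: "(F has_derivative F' x) (at x)" for x
    unfolding F_def F'_def
    by (rule has_derivative_vec_lambda, rule has_derivative_ev)
      (rule bounded_linear.has_derivative[OF bounded_linear_vec_nth], rule has_derivative_ident)
  have contF: "continuous_on UNIV F"
    by (simp add: continuous_on_eq_continuous_within has_derivative_continuous[OF F])
  have "finite ((\<lambda>x. x $ k) ` ?S)" for k
  proof (rule ccontr)
    assume inf: "infinite ((\<lambda>x. x $ k) ` ?S)"
    obtain B c where nz: "\<exists>a<B. \<exists>m\<in>expo_box B. c a m \<noteq> 0"
      and rel: "(\<Sum>a<B. \<Sum>m\<in>expo_box B. Const (c a m) *
        (Var k ^ a * (\<Prod>i\<in>UNIV. G i ^ Poly_Mapping.lookup m i))) = 0"
      using algebraic_dependence[of "Var k" G] by blast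
    obtain T where T: "finite T" "card T = B" "T \<subseteq> (\<lambda>x. x $ k) ` ?S"
      using infinite_arbitrarily_large[OF inf] by blast
    obtain U where U: "U \<subseteq> ?S" "inj_on (\<lambda>x. x $ k) U" "T = (\<lambda>x. x $ k) ` U"
      using T(3)[unfolded subset_image_inj] by (elim exE conjE)
    have finU: "finite U" "card U = B" using T U by (auto simp: finite_image_iff card_image)
    \<comment> \<open>Half the least distance between the \<open>k\<close>-th coordinates of points
      of \<open>U\<close>, so that points in balls of radius \<open>e\<close> around distinct points
      of \<open>U\<close> still differ in coordinate \<open>k\<close>. The number 1 keeps the set
      nonempty when \<open>U\<close> has a single point.\<close>
    obtain e where e: "e > 0" "\<And>x y. x \<in> U \<Longrightarrow> y \<in> U \<Longrightarrow> x \<noteq> y \<Longrightarrow> 2 * e \<le> norm (x $ k - y $ k)"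
    proof -
      let ?D = "insert 1 ((\<lambda>(x, y). norm (x $ k - y $ k)) ` {(x, y) \<in> U \<times> U. x \<noteq> y})"
      have fin: "finite ?D" using finU by (auto intro: finite_subset[of _ "U \<times> U"])
      have "Min ?D > 0" using fin U(2) by (subst Min_gr_iff) (auto simp: inj_on_def)
      moreover have "Min ?D \<le> norm (x $ k - y $ k)" if "x \<in> U" "y \<in> U" "x \<noteq> y" for x y
        using fin that by (intro Min_le) auto
      ultimately show ?thesis by (intro that[of "Min ?D / 2"]) auto
    qed
    \<comment> \<open>Every value in \<open>W\<close> is attained by \<open>F\<close> near each
      point of \<open>U\<close> simultaneously.\<close>
    define W where "W = (\<Inter>x\<in>U. interior (F ` ball x e))"
    have "open W" unfolding W_def using finU by (intro open_INT) auto
    moreover have "(\<chi> i. b i) \<in> W"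
      unfolding W_def
    proof
      fix x assume "x \<in> U"
      then have x: "F x = (\<chi> i. b i)" "\<And>y. F' x y = 0 \<Longrightarrow> y = 0"
        using U(1) by (auto simp: F_def F'_def vec_eq_iff)
      \<comment> \<open>Nondegeneracy makes the derivative injective, hence bijective on a
        finite-dimensional space; its inverse \<open>g\<close> is the right inverse that the open
        mapping theorem takes as input.\<close>
      have lin: "linear (F' x)" using F has_derivative_linear by blast
      moreover have "inj (F' x)" using x(2) linear_injective_0[OF lin] by blast
      ultimately obtain g where g: "linear g" "\<And>z. F' x (g z) = z"
        using linear_injective_isomorphism by blast
      have "F x \<in> interior (F ` ball x e)"
        by (rule sussmann_open_mapping[OF open_UNIV contF _ F, of x g])
          (use g e in \<open>auto simp: linear_conv_bounded_linear[symmetric] fun_eq_iff\<close>)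
      then show "(\<chi> i. b i) \<in> interior (F ` ball x e)" using x by simp
    qed
    \<comment> \<open>An open neighbourhood of \<open>b\<close> contains a product of open sets
      \<open>A i\<close>. These are infinite, so they form a grid on which the nonzero polynomial
      \<open>q a0\<close> cannot vanish identically.\<close>
    ultimately obtain A where A: "\<And>i. open (A i)" "\<And>i. b i \<in> A i"
      "\<And>w. (\<And>i. w $ i \<in> A i) \<Longrightarrow> w \<in> W"
      unfolding open_vec_def by (metis vec_lambda_beta)
    \<comment> \<open>The algebraic relation is read as a polynomial in the coordinate
      \<open>k\<close>, whose coefficient at the power \<open>a\<close> is \<open>q a\<close>
      evaluated at the values of \<open>G\<close>.\<close>
    define q where "q a = (\<Sum>m\<in>expo_box B. Poly_Mapping.single m (c a m))" for a
    have lookup_q: "Poly_Mapping.lookup (q a) m = (if m \<in> expo_box B then c a m else 0)" for a m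
      by (simp add: q_def lookup_sum lookup_single when_def)
    have ev_q: "ev w (q a) = (\<Sum>m\<in>expo_box B. c a m * (\<Prod>i\<in>UNIV. w i ^ Poly_Mapping.lookup m i))" for w a
      by (simp add: q_def poly_eval_sum poly_eval_single)
    obtain a0 m0 where a0: "a0 < B" "m0 \<in> expo_box B" "c a0 m0 \<noteq> 0" using nz by blast
    then have "q a0 \<noteq> 0" using lookup_q[of a0 m0] by auto
    moreover have "infinite (A i) \<or> B \<le> card (A i)" for i
      using A(1,2)[of i] finite_imp_not_open[of "A i"] by blast
    moreover have "Poly_Mapping.lookup m i < B" if "m \<in> Poly_Mapping.keys (q a0)" for m i
      using that lookup_q[of a0 m] by (auto simp: in_keys_iff expo_box_def split: if_splits)
    ultimately obtain w where w: "\<And>i. w i \<in> A i" "ev w (q a0) \<noteq> 0"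
      using cpoly_eq_0_grid[of A B "q a0"] by blast
    have "(\<chi> i. w i) \<in> W" by (rule A(3)) (simp add: w)
    then have "\<forall>x\<in>U. \<exists>z. z \<in> ball x e \<and> F z = (\<chi> i. w i)"
      unfolding W_def using interior_subset by fastforce
    then obtain h where h: "\<And>x. x \<in> U \<Longrightarrow> h x \<in> ball x e" "\<And>x. x \<in> U \<Longrightarrow> F (h x) = (\<chi> i. w i)"
      by metis
    have inj: "inj_on (\<lambda>x. h x $ k) U"
    proof (rule inj_onI, rule ccontr)
      fix x y assume xy: "x \<in> U" "y \<in> U" "h x $ k = h y $ k" "x \<noteq> y"
      have *: "norm (z $ k - h z $ k) < e" if "z \<in> U" for z
        using h(1)[OF that] Finite_Cartesian_Product.norm_nth_le[of "z - h z" k]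
        by (simp add: dist_norm)
      have "norm (x $ k - y $ k) = norm ((x $ k - h x $ k) - (y $ k - h y $ k))" using xy by simp
      also have "\<dots> \<le> norm (x $ k - h x $ k) + norm (y $ k - h y $ k)" by (rule norm_triangle_ineq4)
      also have "\<dots> < e + e" by (intro add_strict_mono * xy)
      finally show False using e(2)[of x y] xy by simp
    qed
    \<comment> \<open>All points \<open>h x\<close> lie in the same fiber over \<open>w\<close>, so
      their \<open>k\<close>-th coordinates are roots of one and the same polynomial, whose
      coefficient at \<open>a0\<close> was made nonzero by the choice of \<open>w\<close>.\<close>
    have "(\<Sum>a<B. ev w (q a) * z ^ a) = 0" if z: "z \<in> (\<lambda>x. h x $ k) ` U" for z
    proof -
      obtain x where x: "x \<in> U" "z = h x $ k" using z by blast
      have G: "ev (($) (h x)) (G i) = w i" for i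
        using h(2)[OF x(1)] by (simp add: F_def vec_eq_iff)
      have "0 = ev (($) (h x)) (\<Sum>a<B. \<Sum>m\<in>expo_box B. Const (c a m) *
          (Var k ^ a * (\<Prod>i\<in>UNIV. G i ^ Poly_Mapping.lookup m i)))"
        unfolding rel by simp
      also have "\<dots> = (\<Sum>a<B. ev w (q a) * z ^ a)"
        by (simp add: ev_simps G x(2) ev_q sum_distrib_left sum_distrib_right mult_ac)
      finally show ?thesis by simp
    qed
    moreover have "B \<le> card ((\<lambda>x. h x $ k) ` U)" using inj finU by (simp add: card_image)
    ultimately have "ev w (q a0) = 0"
      using polynomial_many_roots[of "(\<lambda>x. h x $ k) ` U" B "\<lambda>a. ev w (q a)" a0] a0(1) by simp
    then show False using w(2) by simp
  qed
  then have "finite {x :: complex^'v. \<forall>k. x $ k \<in> (\<lambda>x. x $ k) ` ?S}" by (rule finite_vec_box)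
  then show ?thesis by (rule rev_finite_subset) blast
qed

text \<open>This cuts an overdetermined finite system down to a square one, as
  \<open>finite_nondegenerate_fiber\<close> requires. The selection \<open>s\<close> may repeat
  elements, so it suffices to find a nonempty subset with at most \<open>CARD('v)\<close> elements
  and trivial common kernel.\<close>

lemma select_functionals:
  fixes \<phi> :: "'x \<Rightarrow> complex^'v::finite"
  assumes fin: "finite X" and ker: "\<And>y. (\<And>x. x \<in> X \<Longrightarrow> (\<Sum>j\<in>UNIV. y $ j * \<phi> x $ j) = 0) \<Longrightarrow> y = 0"
  shows "\<exists>s :: 'v \<Rightarrow> 'x. range s \<subseteq> X \<and> (\<forall>y. (\<forall>i. (\<Sum>j\<in>UNIV. y $ j * \<phi> (s i) $ j) = 0) \<longrightarrow> y = 0)"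
proof -
  \<comment> \<open>A smallest subset with trivial common kernel is linearly independent.\<close>
  let ?P = "\<lambda>Y. Y \<subseteq> X \<and> (\<forall>y. (\<forall>x\<in>Y. (\<Sum>j\<in>UNIV. y $ j * \<phi> x $ j) = 0) \<longrightarrow> y = 0)"
  have "?P X" using ker by blast
  then obtain Y where Y: "?P Y" and min: "\<And>Z. ?P Z \<Longrightarrow> card Y \<le> card Z"
    using ex_has_least_nat[of ?P X card] by blast
  have finY: "finite Y" using Y fin finite_subset by blast
  have "card Y \<le> CARD('v)"
  proof (rule ccontr)
    assume "\<not> card Y \<le> CARD('v)"
    then obtain u a where u: "a \<in> Y" "u a \<noteq> 0" "\<And>j. (\<Sum>x\<in>Y. u x * \<phi> x $ j) = 0"
      using nontrivial_solution[of "UNIV :: 'v set" Y "\<lambda>x j. \<phi> x $ j"] finY by auto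
    have "?P (Y - {a})"
    proof (intro conjI allI impI)
      fix y assume y: "\<forall>x\<in>Y - {a}. (\<Sum>j\<in>UNIV. y $ j * \<phi> x $ j) = 0"
      have "0 = (\<Sum>j\<in>UNIV. y $ j * (\<Sum>x\<in>Y. u x * \<phi> x $ j))" using u(3) by simp
      also have "\<dots> = (\<Sum>x\<in>Y. u x * (\<Sum>j\<in>UNIV. y $ j * \<phi> x $ j))"
        unfolding sum_distrib_left by (subst sum.swap) (simp add: mult_ac)
      also have "\<dots> = u a * (\<Sum>j\<in>UNIV. y $ j * \<phi> a $ j)"
        using y u(1) finY by (simp add: sum.remove[of Y a])
      finally have "(\<Sum>j\<in>UNIV. y $ j * \<phi> a $ j) = 0" using u(2) by simp
      then have "\<forall>x\<in>Y. (\<Sum>j\<in>UNIV. y $ j * \<phi> x $ j) = 0" using y by blast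
      then show "y = 0" using Y by blast
    qed (use Y in blast)
    then have "card Y \<le> card (Y - {a})" by (rule min)
    then show False using u(1) finY by (metis card_Diff1_less not_le)
  qed
  moreover have "Y \<noteq> {}"
  proof
    assume "Y = {}"
    then have "(\<chi> i. (1 :: complex)) = (0 :: complex^'v)" using Y by blast
    then show False by (simp add: vec_eq_iff)
  qed
  ultimately obtain s :: "'v \<Rightarrow> 'x" where "range s = Y"
    using inj_on_iff_surj[of Y "UNIV :: 'v set"] inj_on_iff_card_le[OF finY, of "UNIV :: 'v set"] by auto
  then show ?thesis using Y by (intro exI[of _ s]) blast
qed

lemma forms_power: "p \<in> forms k \<Longrightarrow> p ^ a \<in> forms (a * k)"
proof (induction a)
  case 0
  then show ?case using forms_Const[of 1] by simp
next
  case (Suc a)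
  then show ?case using forms_mult[of p k "p ^ a" "a * k"] by simp
qed

lemma forms_prod: "(\<And>a. a \<in> A \<Longrightarrow> p a \<in> forms (k a)) \<Longrightarrow> (\<Prod>a\<in>A. p a) \<in> forms (\<Sum>a\<in>A. k a)"
proof (induction A rule: infinite_finite_induct)
  case (insert a A)
  then show ?case by (simp add: forms_mult)
qed (use forms_Const[of 1] in simp_all)

lemma forms_compose_linear:
  assumes "p \<in> forms k" shows "compose_linear p g \<in> forms k"
proof -
  have "Const (Poly_Mapping.lookup p m) * (\<Prod>i\<in>UNIV. (\<Sum>j\<in>UNIV. Const (g $ i $ j) * Var j) ^ Poly_Mapping.lookup m i)
      \<in> forms (mdeg m)" for m
    unfolding mdeg_def
  proof (intro forms_Const_mult forms_prod)
    fix i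
    have "(\<Sum>j\<in>UNIV. Const (g $ i $ j) * Var j) \<in> forms 1"
      by (intro forms_sum forms_Const_mult forms_Var)
    from forms_power[OF this] show "(\<Sum>j\<in>UNIV. Const (g $ i $ j) * Var j) ^ Poly_Mapping.lookup m i
      \<in> forms (Poly_Mapping.lookup m i)" by simp
  qed
  moreover have "mdeg m = k" if "m \<in> Poly_Mapping.keys p" for m
    using assms that by (simp add: forms_def)
  ultimately show ?thesis
    unfolding compose_linear_def poly_eval_def by (intro forms_sum) fastforce
qed

lemma sum_UNIV_prod: "(\<Sum>p\<in>UNIV. h p) = (\<Sum>a\<in>UNIV. \<Sum>b\<in>UNIV. h (a, b))"
  by (simp add: sum.cartesian_product)

text \<open>Each element of the stabilizer is a nondegenerate solution of a square system chosen by
  a map \<open>s\<close> from matrix positions to a finite grid. There are finitely many such maps,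
  and each system contributes finitely many solutions.\<close>

lemma finite_linear_stabilizer:
  fixes f :: "'n::finite cpoly"
  assumes f: "f \<in> forms (Suc d)"
    and sym: "\<And>B. infinitesimal_symmetry f B \<Longrightarrow> B = 0"
  shows "finite {g. invertible g \<and> (\<forall>v. ev (($) (g *v v)) f = ev (($) v) f)}" (is "finite ?V")
proof -
  \<comment> \<open>With \<open>d + 2\<close> values for each coordinate the grid detects whether a
    form of degree \<open>d + 1\<close> is zero.\<close>
  define X :: "(complex^'n) set" where "X = {x. \<forall>i. x $ i \<in> of_nat ` {..Suc d}}"
  have finX: "finite X" unfolding X_def by (rule finite_vec_box) simp
  define vec :: "complex^'n^'n \<Rightarrow> complex^('n \<times> 'n)" where "vec g = (\<chi> p. g $ fst p $ snd p)" for g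
  \<comment> \<open>The value of \<open>f\<close> at the image of the fixed point
    \<open>s i\<close>, as a polynomial in the matrix entries; \<open>vec\<close> lists these
    entries as coordinates.\<close>
  define G where "G s i = poly_eval Const (\<lambda>a. \<Sum>b\<in>UNIV. Const (s i $ b) * Var (a, b)) f"
    for s :: "'n \<times> 'n \<Rightarrow> complex^'n" and i
  \<comment> \<open>The gradient, with respect to the matrix entries, of the value of
    \<open>f\<close> at \<open>g *v x\<close>.\<close>
  define \<phi> :: "complex^'n^'n \<Rightarrow> complex^'n \<Rightarrow> complex^('n \<times> 'n)"
    where "\<phi> g x = (\<chi> p. x $ snd p * ev (($) (g *v x)) (pdiff (fst p) f))" for g x
  have ev_G: "ev (($) y) (G s i) = ev (\<lambda>a. \<Sum>b\<in>UNIV. s i $ b * y $ (a, b)) f" for y s i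
    unfolding G_def ev_poly_eval_Const by (simp add: ev_simps)
  have ev_vec: "(\<lambda>a. \<Sum>b\<in>UNIV. s i $ b * vec g $ (a, b)) = ($) (g *v s i)" for g and s :: "'n \<times> 'n \<Rightarrow> complex^'n" and i
    by (simp add: vec_def matrix_vector_mult_def fun_eq_iff mult.commute)
  have jac: "(\<Sum>j\<in>UNIV. y $ j * ev (($) (vec g)) (pdiff j (G s i))) = (\<Sum>j\<in>UNIV. y $ j * \<phi> g (s i) $ j)"
    for y g s i
  proof -
    \<comment> \<open>Both sides are derivatives at 0 along the line \<open>vec g + t y\<close>:
      once for \<open>G s i\<close> as a polynomial in the entries, once for \<open>f\<close> at the
      moving image point.\<close>
    define Y where "Y t = vec g + (\<chi> j. t * y $ j)" for t :: complex
    have Y0: "Y 0 = vec g" by (simp add: Y_def vec_eq_iff)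
    have 1: "((\<lambda>t. ev (($) (Y t)) (G s i)) has_field_derivative
      (\<Sum>j\<in>UNIV. y $ j * ev (($) (Y 0)) (pdiff j (G s i)))) (at 0)"
      by (rule has_field_derivative_ev) (auto simp: Y_def intro!: derivative_eq_intros)
    have 2: "((\<lambda>t. ev (\<lambda>a. \<Sum>b\<in>UNIV. s i $ b * Y t $ (a, b)) f) has_field_derivative
      (\<Sum>a\<in>UNIV. (\<Sum>b\<in>UNIV. s i $ b * y $ (a, b))
        * ev (\<lambda>a. \<Sum>b\<in>UNIV. s i $ b * Y 0 $ (a, b)) (pdiff a f))) (at 0)"
      by (rule has_field_derivative_ev) (auto simp: Y_def mult.commute intro!: derivative_eq_intros sum.cong)
    have "(\<Sum>j\<in>UNIV. y $ j * ev (($) (vec g)) (pdiff j (G s i)))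
      = (\<Sum>a\<in>UNIV. (\<Sum>b\<in>UNIV. s i $ b * y $ (a, b)) * ev (($) (g *v s i)) (pdiff a f))"
      using DERIV_unique[OF 1[unfolded ev_G] 2] unfolding Y0 ev_vec .
    also have "\<dots> = (\<Sum>a\<in>UNIV. \<Sum>b\<in>UNIV. y $ (a, b) * \<phi> g (s i) $ (a, b))"
      by (simp add: \<phi>_def sum_distrib_left sum_distrib_right mult_ac)
    also have "\<dots> = (\<Sum>j\<in>UNIV. y $ j * \<phi> g (s i) $ j)"
      by (simp add: sum_UNIV_prod)
    finally show ?thesis .
  qed
  let ?S = "\<lambda>s. {x :: complex^('n \<times> 'n). (\<forall>i. ev (($) x) (G s i) = ev (($) (s i)) f) \<and>
    (\<forall>y. (\<forall>i. (\<Sum>j\<in>UNIV. y $ j * ev (($) x) (pdiff j (G s i))) = 0) \<longrightarrow> y = 0)}"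
  have ex: "\<exists>s. range s \<subseteq> X \<and> vec g \<in> ?S s" if g: "g \<in> ?V" for g
  proof -
    have ker: "y = 0" if y: "\<And>x. x \<in> X \<Longrightarrow> (\<Sum>j\<in>UNIV. y $ j * \<phi> g x $ j) = 0" for y
    proof -
      define Y where "Y = (\<chi> a b. y $ (a, b))"
      \<comment> \<open>The first-order change of \<open>compose_linear f g\<close> when
        \<open>g\<close> varies in the direction \<open>Y\<close>. It is a form of degree
        \<open>Suc d\<close>, and the hypothesis on \<open>y\<close> says that it vanishes on the
        grid, so it is 0.\<close>
      define P where "P = (\<Sum>a\<in>UNIV. \<Sum>b\<in>UNIV. Const (Y $ a $ b) * (Var b * compose_linear (pdiff a f) g))"
      have ev_P: "ev (($) x) P = (\<Sum>a\<in>UNIV. (Y *v x) $ a * ev (($) (g *v x)) (pdiff a f))" for x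
        by (simp add: P_def ev_simps ev_compose_linear matrix_vector_mult_def sum_distrib_left
          sum_distrib_right mult_ac)
      have ev_P': "ev (($) x) P = (\<Sum>j\<in>UNIV. y $ j * \<phi> g x $ j)" for x
      proof -
        have "ev (($) x) P = (\<Sum>a\<in>UNIV. \<Sum>b\<in>UNIV. y $ (a, b) * \<phi> g x $ (a, b))"
          by (simp add: P_def ev_simps ev_compose_linear \<phi>_def Y_def)
        then show ?thesis
          by (simp add: sum_UNIV_prod)
      qed
      have "Var b * compose_linear (pdiff a f) g \<in> forms (Suc d)" for a b
        using forms_mult[OF forms_Var forms_compose_linear[OF pdiff_forms[OF f]]] by simp
      then have P: "P \<in> forms (Suc d)"
        unfolding P_def by (intro forms_sum forms_Const_mult)
      have "P = 0"
      proof (rule cpoly_eq_0_grid[where S = "\<lambda>_. of_nat ` {..Suc d}" and B = "Suc (Suc d)"])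
        show "infinite (of_nat ` {..Suc d} :: complex set) \<or> Suc (Suc d) \<le> card (of_nat ` {..Suc d} :: complex set)"
          by (simp add: card_image inj_on_def)
        fix m and i assume "m \<in> Poly_Mapping.keys P"
        then have "mdeg m = Suc d" using P by (simp add: forms_def)
        moreover have "Poly_Mapping.lookup m i \<le> mdeg m" unfolding mdeg_def by (rule member_le_sum) auto
        ultimately show "Poly_Mapping.lookup m i < Suc (Suc d)" by simp
      next
        fix x :: "'n \<Rightarrow> complex" assume "\<And>i. x i \<in> of_nat ` {..Suc d}"
        then have "(\<chi> i. x i) \<in> X" by (simp add: X_def)
        from y[OF this] show "ev x P = 0" unfolding ev_P'[symmetric] by simp
      qed
      \<comment> \<open>Substituting \<open>g' *v v\<close> for the argument of \<open>P\<close>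
        moves the variation from \<open>g\<close> to the identity, where it becomes the
        infinitesimal symmetry \<open>Y ** g'\<close>.\<close>
      obtain g' where g': "g ** g' = mat 1" "g' ** g = mat 1" using g by (auto simp: invertible_def)
      have "infinitesimal_symmetry f (Y ** g')"
        unfolding infinitesimal_symmetry_def
      proof
        fix v
        have "(\<Sum>a\<in>UNIV. (Y *v (g' *v v)) $ a * ev (($) (g *v (g' *v v))) (pdiff a f)) = 0"
          unfolding ev_P[symmetric] \<open>P = 0\<close> by simp
        then show "(\<Sum>i\<in>UNIV. (Y ** g' *v v) $ i * ev (($) v) (pdiff i f)) = 0"
          by (simp add: matrix_vector_mul_assoc g')
      qed
      then have "Y ** g' = 0" by (rule sym)
      then have "Y ** (g' ** g) = 0" by (simp add: matrix_mul_assoc)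
      then have "Y = 0" by (simp add: g')
      then show "y = 0" by (simp add: Y_def vec_eq_iff)
    qed
    have "\<exists>s :: 'n \<times> 'n \<Rightarrow> complex^'n. range s \<subseteq> X \<and> (\<forall>y. (\<forall>i. (\<Sum>j\<in>UNIV. y $ j * \<phi> g (s i) $ j) = 0) \<longrightarrow> y = 0)"
      by (rule select_functionals[OF finX]) (rule ker)
    then obtain s :: "'n \<times> 'n \<Rightarrow> complex^'n" where s: "range s \<subseteq> X" "\<forall>y. (\<forall>i. (\<Sum>j\<in>UNIV. y $ j * \<phi> g (s i) $ j) = 0) \<longrightarrow> y = 0"
      by (elim exE conjE)
    moreover have "ev (($) (vec g)) (G s i) = ev (($) (s i)) f" for i
      unfolding ev_G ev_vec using g by simp
    ultimately show ?thesis by (intro exI[of _ s]) (simp add: jac)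
  qed
  have "vec g \<in> (\<Union>s\<in>PiE UNIV (\<lambda>_. X). ?S s)" if g: "g \<in> ?V" for g
  proof -
    obtain s where s: "range s \<subseteq> X" "vec g \<in> ?S s" using ex[OF g] by blast
    then have "s \<in> PiE UNIV (\<lambda>_. X)" by (auto simp: PiE_def)
    show ?thesis by (rule UN_I) fact+
  qed
  then have "vec ` ?V \<subseteq> (\<Union>s\<in>PiE UNIV (\<lambda>_. X). ?S s)" by (rule image_subsetI)
  moreover have "finite (\<Union>s\<in>PiE UNIV (\<lambda>_. X). ?S s)"
    using finX by (intro finite_UN_I finite_PiE finite_nondegenerate_fiber) auto
  ultimately have "finite (vec ` ?V)" by (rule finite_subset)
  moreover have "inj_on vec ?V" by (auto simp: inj_on_def vec_def vec_eq_iff)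
  ultimately show ?thesis by (rule finite_imageD)
qed


section \<open>Dimensions of the graded pieces\<close>

text \<open>Spans, bases and dimensions are handled in this complex vector space first and are
  carried over to the subfield dimension in \<open>vdim\<close> by
  \<open>dimension_hom_image\<close>.\<close>

interpretation cpoly: vector_space "\<lambda>c (p :: 'v cpoly). Const c * p"
  by unfold_locales (simp_all add: Const_add Const_mult algebra_simps)

lemma subspace_forms: "cpoly.subspace (forms k)"
  by (rule cpoly.subspaceI) (auto intro: forms_add forms_Const_mult)

lemma span_subset_forms: "S \<subseteq> forms k \<Longrightarrow> cpoly.span S \<subseteq> forms k"
  by (rule cpoly.span_minimal[OF _ subspace_forms])

text \<open>The relation concerns the family, while \<open>dim\<close> sees only the set of its
  values. For injective \<open>p\<close> the two agree; a repeated value yields the relation with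
  coefficients 1 and -1, and then the range is too small as well.\<close>

lemma dim_range_less_iff:
  fixes p :: "'i::finite \<Rightarrow> 'v cpoly"
  shows "cpoly.dim (range p) < CARD('i) \<longleftrightarrow>
    (\<exists>c. (\<exists>i. c i \<noteq> 0) \<and> (\<Sum>i\<in>UNIV. Const (c i) * p i) = 0)" (is "_ \<longleftrightarrow> ?R")
proof (cases "inj p")
  case True
  have card: "card (range p) = CARD('i)" using True by (simp add: card_image)
  have "?R \<longleftrightarrow> cpoly.dependent (range p)"
  proof
    assume ?R
    then obtain c where c: "\<exists>i. c i \<noteq> 0" "(\<Sum>i\<in>UNIV. Const (c i) * p i) = 0" by blast
    have "(\<Sum>v\<in>range p. Const (c (inv_into UNIV p v)) * v) = 0"
      using c(2) True by (simp add: sum.reindex)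
    then show "cpoly.dependent (range p)"
      unfolding cpoly.dependent_finite[OF finite_imageI[OF finite]]
      using c(1) True by (intro exI[of _ "\<lambda>v. c (inv_into UNIV p v)"]) auto
  next
    assume "cpoly.dependent (range p)"
    then obtain u where u: "\<exists>v\<in>range p. u v \<noteq> 0" "(\<Sum>v\<in>range p. Const (u v) * v) = 0"
      unfolding cpoly.dependent_finite[OF finite_imageI[OF finite]] by blast
    then show ?R using True by (intro exI[of _ "u \<circ> p"]) (auto simp: sum.reindex)
  qed
  moreover have "cpoly.dim (range p) < CARD('i) \<longleftrightarrow> cpoly.dependent (range p)"
  proof
    assume "cpoly.dim (range p) < CARD('i)"
    then show "cpoly.dependent (range p)"
      using cpoly.dim_eq_card_independent[of "range p"] card by auto
  next
    assume dep: "cpoly.dependent (range p)"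
    obtain B where B: "B \<subseteq> range p" "cpoly.independent B" "card B = cpoly.dim (range p)"
      by (rule cpoly.basis_exists)
    then have "B \<subset> range p" using dep by blast
    then have "card B < card (range p)" by (intro psubset_card_mono) auto
    then show "cpoly.dim (range p) < CARD('i)" using B card by simp
  qed
  ultimately show ?thesis by simp
next
  case False
  then obtain i j where ij: "i \<noteq> j" "p i = p j" by (auto simp: inj_on_def)
  have "cpoly.dim (range p) \<le> card (range p)"
    by (rule cpoly.dim_le_card) (auto intro: cpoly.span_base)
  also have "card (range p) < CARD('i)"
    using False card_image_le[of UNIV p] eq_card_imp_inj_on[of UNIV p] by fastforce
  finally have "cpoly.dim (range p) < CARD('i)" .
  moreover have "(\<Sum>k\<in>UNIV. Const (if k = i then 1 else if k = j then - 1 else 0) * p k)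
    = p i - p j"
  proof -
    have "(\<Sum>k\<in>UNIV. Const (if k = i then 1 else if k = j then - 1 else 0) * p k)
      = (\<Sum>k\<in>UNIV. (if k = i then p i else 0) - (if k = j then p j else 0))"
      using ij(1) by (intro sum.cong) (auto simp: Const_uminus)
    then show ?thesis by (simp add: sum_subtractf)
  qed
  ultimately show ?thesis
    using ij by (auto intro!: exI[of _ "\<lambda>k. if k = i then 1 else if k = j then - 1 else 0"])
qed

section \<open>Vector space dimension and dimension over a subfield\<close>

lemma poly_ring_simps [simp]:
  "carrier poly_ring = UNIV" "p \<otimes>\<^bsub>poly_ring\<^esub> q = p * q" "p \<oplus>\<^bsub>poly_ring\<^esub> q = p + q"
  "\<one>\<^bsub>poly_ring\<^esub> = 1" "\<zero>\<^bsub>poly_ring\<^esub> = 0"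
  by (simp_all add: poly_ring_def)

lemma ring_poly_ring: "ring poly_ring"
  using poly_ring_cring by (rule cring.axioms)

lemma a_inv_poly_ring [simp]: "\<ominus>\<^bsub>poly_ring\<^esub> p = - p"
proof -
  interpret ring poly_ring by (rule ring_poly_ring)
  show ?thesis by (rule minus_equality) simp_all
qed

abbreviation constants :: "'v cpoly set"
  where "constants \<equiv> {Const c | c. True}"

lemma subfield_constants: "subfield (constants :: 'v cpoly set) poly_ring"
proof -
  interpret cring "poly_ring :: 'v cpoly ring" by (rule poly_ring_cring)
  have inj: "Const c = (0 :: 'v cpoly) \<longleftrightarrow> c = 0" for c
    by (metis Const_def lookup_single_eq lookup_zero single_zero)
  show ?thesis
  proof (rule subfieldI, rule subcringI)
    show "subring constants (poly_ring :: 'v cpoly ring)"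
    proof (rule subringI)
      fix h :: "'v cpoly" assume "h \<in> constants"
      then show "\<ominus>\<^bsub>poly_ring\<^esub> h \<in> constants" by (auto simp: Const_uminus[symmetric])
    next
      fix g h :: "'v cpoly" assume "g \<in> constants" "h \<in> constants"
      then show "g \<otimes>\<^bsub>poly_ring\<^esub> h \<in> constants" "g \<oplus>\<^bsub>poly_ring\<^esub> h \<in> constants"
        by (auto simp: Const_mult[symmetric] Const_add[symmetric])
    qed (auto simp: Const_1[symmetric] simp del: Const_1)
    show "Units (poly_ring \<lparr> carrier := constants \<rparr>) = constants - {\<zero>\<^bsub>poly_ring\<^esub> :: 'v cpoly}"
    proof (intro equalityI subsetI)
      fix x :: "'v cpoly" assume "x \<in> Units (poly_ring \<lparr> carrier := constants \<rparr>)"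
      then show "x \<in> constants - {\<zero>\<^bsub>poly_ring\<^esub>}" by (auto simp: Units_def poly_ring_def)
    next
      fix x :: "'v cpoly" assume "x \<in> constants - {\<zero>\<^bsub>poly_ring\<^esub>}"
      then obtain c where c: "x = Const c" by auto
      then have "c \<noteq> 0" using inj[of c] \<open>x \<in> _\<close> by auto
      then have "Const (inverse c) * x = 1" "x * Const (inverse c) = 1"
        unfolding c using \<open>c \<noteq> 0\<close> by (simp_all add: Const_mult[symmetric])
      then show "x \<in> Units (poly_ring \<lparr> carrier := constants \<rparr>)"
        using c by (auto simp: Units_def poly_ring_def)
    qed
  qed (simp add: mult.commute)
qed

lemma vdim_eqI:
  assumes "ring R" "subfield K R" "ring.dimension R n K E"
  shows "vdim R K E = n"
  unfolding vdim_def using assms ring.dimension_is_inj[OF assms(1,2)] by blast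

text \<open>Since \<open>h\<close> is injective on the span, each new basis vector \<open>v\<close>
  gives a genuine line extension by \<open>h v\<close>, which is one step of the inductive dimension
  predicate. The identity handles the ideal, the residue map the quotient.\<close>

lemma dimension_hom_image:
  fixes h :: "'v cpoly \<Rightarrow> 'r" and R :: "('r, 'm) ring_scheme"
  assumes hom: "ring_hom_ring poly_ring R h"
    and fin: "finite B" and indep: "cpoly.independent B"
    and ker: "\<And>p. p \<in> cpoly.span B \<Longrightarrow> h p = \<zero>\<^bsub>R\<^esub> \<Longrightarrow> p = 0"
  shows "ring.dimension R (card B) (h ` constants) (h ` cpoly.span B)"
proof -
  interpret h: ring_hom_ring poly_ring R h by (rule hom)
  have h_add: "h (p + q) = h p \<oplus>\<^bsub>R\<^esub> h q" and h_mult: "h (p * q) = h p \<otimes>\<^bsub>R\<^esub> h q" for p q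
    using h.hom_add[of p q] h.hom_mult[of p q] by simp_all
  have h_0: "h 0 = \<zero>\<^bsub>R\<^esub>" using h.hom_zero by simp
  have h_carrier: "h p \<in> carrier R" for p using h.hom_closed[of p] by simp
  have h_eq: "h (p - q) = \<zero>\<^bsub>R\<^esub>" if pq: "h p = h q" for p q
    using h_add[of "p - q" q] pq h_carrier h.S.add.r_cancel_one'[of "h q" "h (p - q)"] by simp
  show ?thesis using fin indep ker
  proof (induction B rule: finite_induct)
    case empty
    then show ?case by (simp add: h_0 h.S.dimension.zero_dim)
  next
    case (insert v B)
    have v: "v \<notin> cpoly.span B" "cpoly.independent B"
      using insert.prems(1) insert.hyps(2) by (simp_all add: cpoly.independent_insert)
    have sub: "cpoly.span B \<subseteq> cpoly.span (insert v B)" by (intro cpoly.span_mono) auto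
    have "h v \<notin> h ` cpoly.span B"
    proof
      assume "h v \<in> h ` cpoly.span B"
      then obtain w where w: "w \<in> cpoly.span B" "h v = h w" by blast
      have "v - w \<in> cpoly.span (insert v B)"
        using w(1) sub cpoly.span_base[of v "insert v B"] by (intro cpoly.span_diff) auto
      then have "v - w = 0" using insert.prems(2) h_eq[OF w(2)] by blast
      then show False using v(1) w(1) by simp
    qed
    moreover have "ring.dimension R (card B) (h ` constants) (h ` cpoly.span B)"
      using insert.IH[OF v(2)] insert.prems(2) sub by blast
    ultimately have "ring.dimension R (Suc (card B)) (h ` constants)
        (ring.line_extension R (h ` constants) (h v) (h ` cpoly.span B))"
      using h_carrier h.S.dimension.Suc_dim by blast
    moreover have "ring.line_extension R (h ` constants) (h v) (h ` cpoly.span B) = h ` cpoly.span (insert v B)"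
    proof (intro equalityI subsetI)
      fix u assume "u \<in> ring.line_extension R (h ` constants) (h v) (h ` cpoly.span B)"
      then obtain c w where w: "w \<in> cpoly.span B" and u: "u = h (Const c) \<otimes>\<^bsub>R\<^esub> h v \<oplus>\<^bsub>R\<^esub> h w"
        unfolding h.S.line_extension_mem_iff by blast
      have "u = h (Const c * v + w)" unfolding u h_add h_mult ..
      moreover have "Const c * v + w \<in> cpoly.span (insert v B)"
        using w sub cpoly.span_base[of v "insert v B"]
        by (intro cpoly.span_add cpoly.span_scale) auto
      ultimately show "u \<in> h ` cpoly.span (insert v B)" by blast
    next
      fix u assume "u \<in> h ` cpoly.span (insert v B)"
      then obtain p where p: "p \<in> cpoly.span (insert v B)" "u = h p" by blast
      then obtain c where c: "p - Const c * v \<in> cpoly.span B"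
        unfolding cpoly.span_breakdown_eq by blast
      have "u = h (Const c) \<otimes>\<^bsub>R\<^esub> h v \<oplus>\<^bsub>R\<^esub> h (p - Const c * v)"
        unfolding p(2) h_mult[symmetric] h_add[symmetric] by simp
      then show "u \<in> ring.line_extension R (h ` constants) (h v) (h ` cpoly.span B)"
        unfolding h.S.line_extension_mem_iff using c by blast
    qed
    ultimately show ?case using insert.hyps by simp
  qed
qed

lemma vdim_hom_image:
  fixes h :: "'v cpoly \<Rightarrow> 'r" and R :: "('r, 'm) ring_scheme"
  assumes "ring_hom_ring poly_ring R h" "\<one>\<^bsub>R\<^esub> \<noteq> \<zero>\<^bsub>R\<^esub>"
    and "finite B" "cpoly.independent B"
    and "\<And>p. p \<in> cpoly.span B \<Longrightarrow> h p = \<zero>\<^bsub>R\<^esub> \<Longrightarrow> p = 0"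
  shows "vdim R (h ` constants) (h ` cpoly.span B) = card B"
proof (rule vdim_eqI)
  show "ring R" using assms(1) by (rule ring_hom_ring.axioms)
  show "subfield (h ` constants) R"
    by (rule ring_hom_ring.img_is_subfield[OF assms(1) subfield_constants assms(2)])
qed (rule dimension_hom_image[OF assms(1,3,4,5)])

lemma vdim_poly_ring:
  assumes "finite B" "cpoly.independent B"
  shows "vdim poly_ring constants (cpoly.span B :: 'v cpoly set) = card B"
proof -
  have "id \<in> ring_hom (poly_ring :: 'v cpoly ring) poly_ring"
    by (rule ring_hom_memI) simp_all
  then have "ring_hom_ring (poly_ring :: 'v cpoly ring) poly_ring id"
    by (intro ring_hom_ringI2 ring_poly_ring)
  from vdim_hom_image[OF this _ assms] show ?thesis by simp
qed

section \<open>The Jacobian ideal in the degree of the form\<close>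

lemma jacobian_ideal_eq:
  fixes f :: "'n::finite cpoly"
  shows "jacobian_ideal f = {\<Sum>i\<in>UNIV. a i * pdiff i f | a. True}"
  (is "_ = ?I")
proof -
  interpret ring poly_ring by (rule ring_poly_ring)
  have I: "(\<Sum>i\<in>UNIV. a i * pdiff i f) \<in> ?I" for a by blast
  have "ideal ?I poly_ring"
  proof (rule idealI[OF ring_poly_ring])
    show "subgroup ?I (add_monoid poly_ring)"
    proof (rule add.subgroupI)
      show "?I \<noteq> {}" by blast
    next
      fix p assume "p \<in> ?I"
      then obtain a where "p = (\<Sum>i\<in>UNIV. a i * pdiff i f)" by blast
      then have "\<ominus>\<^bsub>poly_ring\<^esub> p = (\<Sum>i\<in>UNIV. - a i * pdiff i f)" by (simp add: sum_negf)
      then show "\<ominus>\<^bsub>poly_ring\<^esub> p \<in> ?I" using I by (simp only:)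
    next
      fix p q assume "p \<in> ?I" "q \<in> ?I"
      then obtain a b where "p = (\<Sum>i\<in>UNIV. a i * pdiff i f)" "q = (\<Sum>i\<in>UNIV. b i * pdiff i f)" by blast
      then have "p \<oplus>\<^bsub>poly_ring\<^esub> q = (\<Sum>i\<in>UNIV. (a i + b i) * pdiff i f)"
        by (simp add: sum.distrib distrib_right)
      then show "p \<oplus>\<^bsub>poly_ring\<^esub> q \<in> ?I" using I by (simp only:)
    qed simp
  next
    fix p x assume "p \<in> ?I"
    then obtain a where "p = (\<Sum>i\<in>UNIV. a i * pdiff i f)" by blast
    then have *: "x * p = (\<Sum>i\<in>UNIV. (x * a i) * pdiff i f)" by (simp add: sum_distrib_left mult_ac)
    show "x \<otimes>\<^bsub>poly_ring\<^esub> p \<in> ?I" "p \<otimes>\<^bsub>poly_ring\<^esub> x \<in> ?I"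
      unfolding poly_ring_simps mult.commute[of p x] * by (rule I)+
  qed
  moreover have "{pdiff i f | i. True} \<subseteq> ?I"
  proof clarify
    fix j
    have "(\<Sum>i\<in>UNIV. (if i = j then 1 else 0) * pdiff i f) = (\<Sum>i\<in>UNIV. if i = j then pdiff i f else 0)"
      by (intro sum.cong) auto
    then have "pdiff j f = (\<Sum>i\<in>UNIV. (if i = j then 1 else 0) * pdiff i f)" by simp
    then show "\<exists>a. pdiff j f = (\<Sum>i\<in>UNIV. a i * pdiff i f) \<and> True"
      by (intro exI[of _ "\<lambda>i. if i = j then 1 else 0"]) blast
  qed
  ultimately have "jacobian_ideal f \<subseteq> ?I"
    unfolding jacobian_ideal_def by (rule genideal_minimal)
  moreover have "?I \<subseteq> jacobian_ideal f"
  proof clarify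
    fix a
    interpret J: ideal "jacobian_ideal f" poly_ring
      unfolding jacobian_ideal_def by (rule genideal_ideal) simp
    have "pdiff i f \<in> jacobian_ideal f" for i
      unfolding jacobian_ideal_def using genideal_self by fastforce
    then have "a i * pdiff i f \<in> jacobian_ideal f" for i
      using J.I_l_closed[of "pdiff i f" "a i"] by simp
    moreover have "p + q \<in> jacobian_ideal f" if "p \<in> jacobian_ideal f" "q \<in> jacobian_ideal f" for p q
      using additive_subgroup.a_closed[OF J.is_additive_subgroup that] by simp
    moreover have "0 \<in> jacobian_ideal f" using additive_subgroup.zero_closed[OF J.is_additive_subgroup] by simp
    ultimately have "(\<Sum>i\<in>A. a i * pdiff i f) \<in> jacobian_ideal f" for A
      by (induction A rule: infinite_finite_induct) auto
    then show "(\<Sum>i\<in>UNIV. a i * pdiff i f) \<in> jacobian_ideal f" .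
  qed
  ultimately show ?thesis by blast
qed

lemma ideal_jacobian_ideal: "ideal (jacobian_ideal f) poly_ring"
  unfolding jacobian_ideal_def by (rule ring.genideal_ideal[OF ring_poly_ring]) simp

definition hom_part :: "nat \<Rightarrow> 'v::finite cpoly \<Rightarrow> 'v cpoly"
  where "hom_part k p = (\<Sum>m | m \<in> Poly_Mapping.keys p \<and> mdeg m = k. Poly_Mapping.single m (Poly_Mapping.lookup p m))"

lemma lookup_hom_part:
  "Poly_Mapping.lookup (hom_part k p) m = (if mdeg m = k then Poly_Mapping.lookup p m else 0)"
  by (auto simp: hom_part_def lookup_sum lookup_single when_def in_keys_iff)

lemma hom_part_forms: "hom_part k p \<in> forms k"
  by (auto simp: forms_def in_keys_iff lookup_hom_part split: if_splits)

lemma hom_part_eq: "p \<in> forms k \<Longrightarrow> hom_part k p = p"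
  by (rule poly_mapping_eqI) (auto simp: lookup_hom_part forms_def in_keys_iff)

lemma hom_part_sum: "hom_part k (\<Sum>a\<in>A. p a) = (\<Sum>a\<in>A. hom_part k (p a))"
  by (rule poly_mapping_eqI) (simp add: lookup_hom_part lookup_sum)

text \<open>The components of \<open>p\<close> outside degree \<open>k\<close> contribute no
  monomial of degree \<open>k + l\<close> after multiplication by a form of degree
  \<open>l\<close>.\<close>

lemma hom_part_mult:
  assumes "q \<in> forms l" shows "hom_part (k + l) (p * q) = hom_part k p * q"
proof (rule poly_mapping_eqI)
  fix m
  let ?r = "p - hom_part k p"
  have pq: "p * q = hom_part k p * q + ?r * q" by (simp add: algebra_simps)
  have r: "mdeg m' \<noteq> k + l" if m': "m' \<in> Poly_Mapping.keys (?r * q)" for m'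
  proof -
    obtain a b where ab: "a \<in> Poly_Mapping.keys ?r" "b \<in> Poly_Mapping.keys q" "m' = a + b"
      using m' keys_mult[of ?r q] by blast
    have "mdeg a \<noteq> k" using ab(1) by (auto simp: in_keys_iff lookup_minus lookup_hom_part)
    moreover have "mdeg b = l" using ab(2) assms by (simp add: forms_def)
    ultimately show ?thesis by (simp add: ab(3) mdeg_def lookup_add sum.distrib)
  qed
  have h: "hom_part k p * q \<in> forms (k + l)" using hom_part_forms assms by (rule forms_mult)
  show "Poly_Mapping.lookup (hom_part (k + l) (p * q)) m = Poly_Mapping.lookup (hom_part k p * q) m"
  proof (cases "mdeg m = k + l")
    case True
    then have "Poly_Mapping.lookup (?r * q) m = 0" using r[of m] by (auto simp: in_keys_iff)
    then show ?thesis using True by (simp add: lookup_hom_part pq lookup_add)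
  next
    case False
    then show ?thesis using h by (auto simp: lookup_hom_part forms_def in_keys_iff)
  qed
qed

text \<open>The partials have degree \<open>k\<close>. Taking the component of degree
  \<open>k + 1\<close> in a combination of them therefore keeps exactly the linear parts of the
  coefficients, which are combinations of the variables.\<close>

lemma jacobian_ideal_forms:
  fixes f :: "'n::finite cpoly"
  assumes f: "f \<in> forms (Suc k)"
  shows "jacobian_ideal f \<inter> forms (Suc k) = cpoly.span (range (\<lambda>(i, j). Var j * pdiff i f))"
    (is "?J = cpoly.span ?X")
proof (intro equalityI subsetI)
  fix p assume p: "p \<in> ?J"
  then obtain a where a: "p = (\<Sum>i\<in>UNIV. a i * pdiff i f)" by (auto simp: jacobian_ideal_eq)
  have "p = hom_part (1 + k) p" using p by (simp add: hom_part_eq)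
  also have "\<dots> = (\<Sum>i\<in>UNIV. hom_part 1 (a i) * pdiff i f)"
    unfolding a hom_part_sum by (intro sum.cong refl hom_part_mult pdiff_forms f)
  also have "\<dots> \<in> cpoly.span ?X"
  proof (rule cpoly.span_sum)
    fix i
    define c where "c j = Poly_Mapping.lookup (hom_part 1 (a i)) (Poly_Mapping.single j 1)" for j
    have "hom_part 1 (a i) = (\<Sum>j\<in>UNIV. Const (c j) * Var j)"
      unfolding c_def by (rule forms_1_eq[OF hom_part_forms])
    then have "hom_part 1 (a i) * pdiff i f = (\<Sum>j\<in>UNIV. Const (c j) * (Var j * pdiff i f))"
      by (simp add: sum_distrib_left sum_distrib_right mult_ac)
    also have "\<dots> \<in> cpoly.span ?X"
      by (intro cpoly.span_sum cpoly.span_scale cpoly.span_base) (auto intro: rev_image_eqI)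
    finally show "hom_part 1 (a i) * pdiff i f \<in> cpoly.span ?X" .
  qed
  finally show "p \<in> cpoly.span ?X" .
next
  interpret J: ideal "jacobian_ideal f" poly_ring by (rule ideal_jacobian_ideal)
  have mem: "pdiff i f \<in> jacobian_ideal f" for i
    unfolding jacobian_ideal_def using ring.genideal_self[OF ring_poly_ring] by fastforce
  have "cpoly.subspace (jacobian_ideal f)"
  proof (rule cpoly.subspaceI)
    show "0 \<in> jacobian_ideal f" using additive_subgroup.zero_closed[OF J.is_additive_subgroup] by simp
    show "p + q \<in> jacobian_ideal f" if "p \<in> jacobian_ideal f" "q \<in> jacobian_ideal f" for p q
      using additive_subgroup.a_closed[OF J.is_additive_subgroup that] by simp
    show "Const c * p \<in> jacobian_ideal f" if "p \<in> jacobian_ideal f" for c p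
      using J.I_l_closed[OF that, of "Const c"] by simp
  qed
  moreover have "?X \<subseteq> jacobian_ideal f"
    using J.I_l_closed[OF mem] by auto
  ultimately have "cpoly.span ?X \<subseteq> jacobian_ideal f" by (intro cpoly.span_minimal)
  moreover have "?X \<subseteq> forms (Suc k)"
    using forms_mult[OF forms_Var pdiff_forms[OF f]] by auto
  then have "cpoly.span ?X \<subseteq> forms (Suc k)" by (rule span_subset_forms)
  ultimately show "p \<in> ?J" if "p \<in> cpoly.span ?X" for p using that by blast
qed

section \<open>Monomial bases and complementary dimensions\<close>

text \<open>An enumeration \<open>e\<close> of the variables turns exponent vectors into lists of
  fixed length and fixed sum, which are counted by stars and bars.\<close>

lemma card_monomials:
  fixes d :: nat
  shows "card {m :: 'n::finite \<Rightarrow>\<^sub>0 nat. mdeg m = d} = (d + CARD('n) - 1) choose d"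
proof -
  let ?N = "CARD('n)"
  obtain e :: "nat \<Rightarrow> 'n" where e: "bij_betw e {..<?N} UNIV"
    using ex_bij_betw_nat_finite[of "UNIV :: 'n set"] by (auto simp: atLeast0LessThan)
  let ?h = "\<lambda>m :: 'n \<Rightarrow>\<^sub>0 nat. map (\<lambda>k. Poly_Mapping.lookup m (e k)) [0..<?N]"
  have s: "sum_list (?h m) = mdeg m" for m
  proof -
    have "sum_list (?h m) = (\<Sum>k<?N. Poly_Mapping.lookup m (e k))"
      by (simp add: sum_list_sum_nth atLeast0LessThan)
    also have "\<dots> = mdeg m" unfolding mdeg_def by (rule sum.reindex_bij_betw[OF e])
    finally show ?thesis .
  qed
  have "bij_betw ?h {m. mdeg m = d} {l :: nat list. length l = ?N \<and> sum_list l = d}"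
  proof (rule bij_betwI')
    fix m m' :: "'n \<Rightarrow>\<^sub>0 nat"
    show "?h m = ?h m' \<longleftrightarrow> m = m'"
    proof
      assume "?h m = ?h m'"
      then have *: "Poly_Mapping.lookup m (e k) = Poly_Mapping.lookup m' (e k)" if "k < ?N" for k
        using that by (simp add: map_eq_conv)
      show "m = m'"
      proof (rule poly_mapping_eqI)
        fix i obtain k where "k < ?N" "i = e k" using e by (force simp: bij_betw_def)
        then show "Poly_Mapping.lookup m i = Poly_Mapping.lookup m' i" using * by simp
      qed
    qed simp
  next
    fix m :: "'n \<Rightarrow>\<^sub>0 nat" assume "m \<in> {m. mdeg m = d}"
    then show "?h m \<in> {l. length l = ?N \<and> sum_list l = d}" using s[of m] by simp
  next
    fix l :: "nat list" assume l: "l \<in> {l. length l = ?N \<and> sum_list l = d}"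
    define m :: "'n \<Rightarrow>\<^sub>0 nat" where "m = Abs_poly_mapping (\<lambda>i. l ! the_inv_into {..<?N} e i)"
    have m: "Poly_Mapping.lookup m i = l ! the_inv_into {..<?N} e i" for i
      unfolding m_def by (subst lookup_Abs_poly_mapping) simp_all
    have "l = ?h m"
      using l e by (intro nth_equalityI) (auto simp: m the_inv_into_f_f bij_betw_def)
    then show "\<exists>m\<in>{m. mdeg m = d}. l = ?h m" using s[of m] l by auto
  qed
  then have "card {m :: 'n \<Rightarrow>\<^sub>0 nat. mdeg m = d} = card {l :: nat list. length l = ?N \<and> sum_list l = d}"
    by (rule bij_betw_same_card)
  then show ?thesis by (simp only: card_length_sum_list)
qed

lemma finite_monomials: "finite {m :: 'n::finite \<Rightarrow>\<^sub>0 nat. mdeg m = d}"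
proof (rule finite_subset)
  show "{m. mdeg m = d} \<subseteq> (expo_box (Suc d) :: ('n \<Rightarrow>\<^sub>0 nat) set)"
    by (auto simp: expo_box_def mdeg_def less_Suc_eq_le intro: member_le_sum)
qed simp

lemma monomial_basis:
  fixes d :: nat
  defines "M \<equiv> (\<lambda>m :: 'n::finite \<Rightarrow>\<^sub>0 nat. Poly_Mapping.single m (1 :: complex)) ` {m. mdeg m = d}"
  shows "cpoly.independent M" "cpoly.span M = forms d" "card M = (d + CARD('n) - 1) choose d"
proof -
  have inj: "inj_on (\<lambda>m :: 'n \<Rightarrow>\<^sub>0 nat. Poly_Mapping.single m (1 :: complex)) S" for S
    by (metis (no_types, lifting) inj_onI lookup_single_eq lookup_single_not_eq one_neq_zero)
  show "card M = (d + CARD('n) - 1) choose d"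
    unfolding M_def card_image[OF inj] by (rule card_monomials)
  have finM: "finite M" by (simp add: M_def finite_monomials)
  show "cpoly.independent M"
  proof
    assume "cpoly.dependent M"
    then obtain u where u: "\<exists>v\<in>M. u v \<noteq> 0" "(\<Sum>v\<in>M. Const (u v) * v) = 0"
      unfolding cpoly.dependent_finite[OF finM] by blast
    then obtain m :: "'n \<Rightarrow>\<^sub>0 nat" where m: "mdeg m = d" "u (Poly_Mapping.single m 1) \<noteq> 0"
      by (auto simp: M_def)
    have "0 = Poly_Mapping.lookup (\<Sum>v\<in>M. Const (u v) * v) m" using u(2) by simp
    also have "\<dots> = (\<Sum>m' | mdeg m' = d. if m' = m then u (Poly_Mapping.single m' 1) else 0)"
      unfolding M_def sum.reindex[OF inj] lookup_sum o_def lookup_Const_mult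
      by (intro sum.cong) (auto simp: lookup_single when_def)
    also have "\<dots> = u (Poly_Mapping.single m 1)" 
      using m(1) by (subst sum.delta[OF finite_monomials]) simp
    finally show False using m(2) by simp
  qed
  show "cpoly.span M = forms d"
  proof
    show "cpoly.span M \<subseteq> forms d"
      by (rule span_subset_forms) (auto simp: M_def forms_def)
    show "forms d \<subseteq> cpoly.span M"
    proof
      fix p :: "'n cpoly" assume p: "p \<in> forms d"
      have "p = (\<Sum>m\<in>Poly_Mapping.keys p. Const (Poly_Mapping.lookup p m) * Poly_Mapping.single m 1)"
        unfolding single_eq_Const_mult[symmetric] by (rule poly_sum_monomials[symmetric])
      also have "\<dots> \<in> cpoly.span M"
        using p by (intro cpoly.span_sum cpoly.span_scale cpoly.span_base) (auto simp: M_def forms_def)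
      finally show "p \<in> cpoly.span M" .
    qed
  qed
qed

text \<open>The coordinates of \<open>p\<close> with respect to \<open>B \<union> C\<close> are
  supported both in \<open>B\<close> and in \<open>C\<close>, hence nowhere.\<close>

lemma span_disjoint_inter:
  assumes "cpoly.independent (B \<union> C)" "B \<inter> C = {}" "p \<in> cpoly.span B" "p \<in> cpoly.span C"
  shows "p = 0"
proof -
  let ?r = "cpoly.representation (B \<union> C) p"
  have "?r = cpoly.representation B p" "?r = cpoly.representation C p"
    using assms by (auto intro: cpoly.representation_extend)
  then have "?r b = 0" for b
    using cpoly.representation_ne_zero[of B p b] cpoly.representation_ne_zero[of C p b] assms(2)
    by (metis IntI empty_iff)
  moreover have "p \<in> cpoly.span (B \<union> C)" using assms(3) cpoly.span_mono[of B "B \<union> C"] by blast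
  ultimately show ?thesis using cpoly.sum_nonzero_representation_eq[OF assms(1), of p] by simp
qed

text \<open>A basis \<open>B\<close> of the ideal in degree \<open>Suc k\<close> extends to a basis
  \<open>C\<close> of all forms of that degree. The residue map kills the span of \<open>B\<close>
  and is injective on the span of \<open>C - B\<close>, so the two dimensions are the cardinalities
  of \<open>B\<close> and \<open>C - B\<close>.\<close>

lemma dim_jacobian:
  fixes f :: "'n::finite cpoly"
  assumes f: "f \<in> forms (Suc k)" and k: "k > 0"
  shows "dim_jacobian_ideal f (Suc k) = cpoly.dim (range (\<lambda>(i, j). Var j * pdiff i f))"
    and "dim_jacobian_ideal f (Suc k) + dim_jacobian_algebra f (Suc k) = (CARD('n) + k) choose (Suc k)"
proof -
  let ?X = "range (\<lambda>(i, j). Var j * pdiff i f)" and ?J = "jacobian_ideal f" and ?F = "forms (Suc k) :: 'n cpoly set"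
  interpret J: ideal ?J poly_ring by (rule ideal_jacobian_ideal)
  obtain B where B: "B \<subseteq> ?X" "cpoly.independent B" "?X \<subseteq> cpoly.span B" "card B = cpoly.dim ?X"
    by (rule cpoly.basis_exists)
  have finB: "finite B" using B(1) finite_subset by fastforce
  have "cpoly.span B = cpoly.span ?X" using B(1,3) by (simp add: cpoly.span_eq cpoly.span_superset subset_trans)
  then have spanB: "cpoly.span B = ?J \<inter> ?F" using jacobian_ideal_forms[OF f] by simp
  show dimJ: "dim_jacobian_ideal f (Suc k) = cpoly.dim ?X"
    unfolding dim_jacobian_ideal_def spanB[symmetric] using vdim_poly_ring[OF finB B(2)] B(4) by simp
  have "B \<subseteq> ?F" using cpoly.span_superset[of B] spanB by blast
  then obtain C where C: "B \<subseteq> C" "C \<subseteq> ?F" "cpoly.independent C" "?F \<subseteq> cpoly.span C"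
    using cpoly.maximal_independent_subset_extend[OF _ B(2)] by blast
  have spanC: "cpoly.span C = ?F" using C span_subset_forms by blast
  let ?M = "(\<lambda>m :: 'n \<Rightarrow>\<^sub>0 nat. Poly_Mapping.single m (1 :: complex)) ` {m. mdeg m = Suc k}"
  have finM: "finite ?M" by (simp add: finite_monomials)
  have finC: "finite C"
    using cpoly.independent_span_bound[OF finM C(3)] C(2) monomial_basis(2)[where 'n = 'n] by blast
  have "card C = cpoly.dim ?F" using C by (intro cpoly.basis_card_eq_dim)
  also have "\<dots> = card ?M"
    using cpoly.dim_span_eq_card_independent[OF monomial_basis(1)] monomial_basis(2)[where 'n = 'n] by metis
  also have "\<dots> = (CARD('n) + k) choose (Suc k)" using monomial_basis(3)[where 'n = 'n] by (simp add: add.commute)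
  finally have cardC: "card C = (CARD('n) + k) choose (Suc k)" .
  let ?Q = "jacobian_algebra f"
  have rc: "residue_class f = (+>\<^bsub>poly_ring\<^esub>) ?J" by (simp add: residue_class_def fun_eq_iff)
  have hom: "ring_hom_ring poly_ring ?Q (residue_class f)"
    unfolding jacobian_algebra_def rc by (rule J.rcos_ring_hom_ring)
  interpret h: ring_hom_ring poly_ring ?Q "residue_class f" by (rule hom)
  have zero: "\<zero>\<^bsub>?Q\<^esub> = ?J" by (simp add: jacobian_algebra_def FactRing_def)
  have ker: "p \<in> ?J" if "residue_class f p = \<zero>\<^bsub>?Q\<^esub>" for p
    using J.rcos_const_imp_mem[of p] that by (simp add: zero residue_class_def)
  have ker': "residue_class f p = \<zero>\<^bsub>?Q\<^esub>" if "p \<in> ?J" for p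
    using J.a_rcos_zero[OF ideal_jacobian_ideal that] by (simp add: zero residue_class_def)
  \<comment> \<open>For \<open>k > 0\<close> all partials vanish at the origin, so 1 is not in the
    ideal. The image of the constants in the quotient is then a field.\<close>
  have "\<one>\<^bsub>?Q\<^esub> \<noteq> \<zero>\<^bsub>?Q\<^esub>"
  proof
    assume "\<one>\<^bsub>?Q\<^esub> = \<zero>\<^bsub>?Q\<^esub>"
    then have "residue_class f 1 = \<zero>\<^bsub>?Q\<^esub>" using h.hom_one by simp
    then have "1 \<in> ?J" by (rule ker)
    then obtain a where "1 = (\<Sum>i\<in>UNIV. a i * pdiff i f)" by (auto simp: jacobian_ideal_eq)
    then have "(1 :: complex) = (\<Sum>i\<in>UNIV. ev (\<lambda>_. 0) (a i) * ev (\<lambda>_. 0) (pdiff i f))"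
      by (metis (no_types, lifting) ev_1 poly_eval_mult poly_eval_sum sum.cong)
    moreover have "ev (\<lambda>_. 0) (pdiff i f) = 0" for i
      using ev_scale[OF pdiff_forms[OF f], of 0 "\<lambda>_. 0"] k by (simp add: power_0_left)
    ultimately show False by simp
  qed
  moreover have indep: "cpoly.independent (C - B)" using C(3) cpoly.dependent_mono by blast
  moreover have "p = 0" if p: "p \<in> cpoly.span (C - B)" "residue_class f p = \<zero>\<^bsub>?Q\<^esub>" for p
  proof (rule span_disjoint_inter[of B "C - B"])
    show "cpoly.independent (B \<union> (C - B))" using C by (simp add: Un_absorb1)
    have "p \<in> cpoly.span C" using p(1) cpoly.span_mono[of "C - B" C] by blast
    then show "p \<in> cpoly.span B" using ker[OF p(2)] unfolding spanB spanC by blast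
  qed (use p in auto)
  ultimately have "vdim ?Q (residue_class f ` constants) (residue_class f ` cpoly.span (C - B)) = card (C - B)"
    using finC by (intro vdim_hom_image hom) auto
  moreover have "residue_class f ` cpoly.span (C - B) = residue_class f ` ?F"
  proof (intro equalityI subsetI)
    fix u assume "u \<in> residue_class f ` ?F"
    then obtain p where p: "p \<in> ?F" "u = residue_class f p" by blast
    then have "p \<in> cpoly.span (B \<union> (C - B))" using spanC C(1) by (simp add: Un_absorb1)
    then obtain x y where xy: "p = x + y" "x \<in> cpoly.span B" "y \<in> cpoly.span (C - B)"
      unfolding cpoly.span_Un by blast
    have "residue_class f p = residue_class f x \<oplus>\<^bsub>?Q\<^esub> residue_class f y"
      using h.hom_add[of x y] xy(1) by simp
    also have "residue_class f x = \<zero>\<^bsub>?Q\<^esub>" using xy(2) spanB by (intro ker') blast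
    also have "\<zero>\<^bsub>?Q\<^esub> \<oplus>\<^bsub>?Q\<^esub> residue_class f y = residue_class f y"
      using h.hom_closed[of y] by simp
    finally show "u \<in> residue_class f ` cpoly.span (C - B)" using p(2) xy(3) by blast
  next
    fix u assume "u \<in> residue_class f ` cpoly.span (C - B)"
    then show "u \<in> residue_class f ` ?F" using cpoly.span_mono[of "C - B" C] spanC by blast
  qed
  ultimately have "dim_jacobian_algebra f (Suc k) = card (C - B)" by (simp add: dim_jacobian_algebra_def)
  moreover have "card B + card (C - B) = card C"
    using C(1) finC finB by (metis card_Diff_subset card_mono le_add_diff_inverse)
  ultimately show "dim_jacobian_ideal f (Suc k) + dim_jacobian_algebra f (Suc k) = (CARD('n) + k) choose (Suc k)"
    using dimJ B(4) cardC by simp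
qed


section \<open>The automorphism group\<close>

lemma krull_dim_pos_iff:
  "krull_dim T > 0 \<longleftrightarrow> (\<exists>Z W. irreducible_closed T Z \<and> irreducible_closed T W \<and> Z \<subset> W)"
proof
  assume "krull_dim T > 0"
  then obtain k and Z :: "nat \<Rightarrow> 'a set" where "enat k > 0"
    "\<forall>i\<le>k. irreducible_closed T (Z i)" "\<forall>i<k. Z i \<subset> Z (Suc i)"
    unfolding krull_dim_def less_Sup_iff by blast
  then show "\<exists>Z W. irreducible_closed T Z \<and> irreducible_closed T W \<and> Z \<subset> W"
    by (intro exI[of _ "Z 0"] exI[of _ "Z 1"]) (auto simp: zero_enat_def)
next
  assume "\<exists>Z W. irreducible_closed T Z \<and> irreducible_closed T W \<and> Z \<subset> W"
  then obtain Z W where "irreducible_closed T Z" "irreducible_closed T W" "Z \<subset> W" by blast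
  then have "\<exists>Y :: nat \<Rightarrow> 'a set. (\<forall>i\<le>1. irreducible_closed T (Y i)) \<and> (\<forall>i<1. Y i \<subset> Y (Suc i))"
    by (intro exI[of _ "\<lambda>i. if i = 0 then Z else W"]) auto
  then show "krull_dim T > 0"
    unfolding krull_dim_def less_Sup_iff by (intro bexI[of _ "enat 1"]) (auto simp: zero_enat_def)
qed

text \<open>All subsets are closed, so an irreducible set with a point \<open>x\<close> cannot be
  split into that point and the rest. Irreducible closed sets are therefore singletons, and none
  contains another properly.\<close>

lemma krull_dim_finite_t1_space:
  assumes "t1_space T" "finite (topspace T)"
  shows "\<not> krull_dim T > 0"
proof -
  have closed: "closedin T S" if "S \<subseteq> topspace T" for S
    using assms that finite_subset t1_space_closedin_finite by blast
  have "\<exists>x. Z = {x}" if Z: "irreducible_closed T Z" for Z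
  proof -
    obtain x where x: "x \<in> Z" using Z by (auto simp: irreducible_closed_def)
    have sub: "Z \<subseteq> topspace T" using Z closedin_subset by (auto simp: irreducible_closed_def)
    have "closedin T {x}" "closedin T (Z - {x})" "Z = {x} \<union> (Z - {x})"
      using x sub by (auto intro!: closed)
    then have "Z = {x} \<or> Z = Z - {x}" using Z unfolding irreducible_closed_def by blast
    then show ?thesis using x by blast
  qed
  then show ?thesis unfolding krull_dim_pos_iff by blast
qed

section \<open>Points and closed sets of the projective linear group\<close>

abbreviation pclass :: "complex^'n::finite^'n \<Rightarrow> (complex^'n^'n) set"
  where "pclass g \<equiv> scalar_matrices #>\<^bsub>GL\<^esub> g"

lemma pclass_eq: "pclass g = {mat c ** g | c. c \<noteq> 0}"
  by (auto simp: r_coset_def scalar_matrices_def GL_def)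

lemma carrier_PGL: "carrier PGL = {pclass g | g. invertible g}"
  by (auto simp: PGL_def FactGroup_def RCOSETS_def GL_def)

lemma pclass_refl: "g \<in> pclass g"
  unfolding pclass_eq by (rule CollectI, rule exI[of _ 1]) simp

lemma pclass_mat_mult:
  assumes "c \<noteq> 0" shows "pclass (mat c ** g) = pclass g"
proof -
  have "\<exists>b. mat a ** g = mat b ** (mat c ** g) \<and> b \<noteq> 0" if "a \<noteq> 0" for a
    using assms that by (intro exI[of _ "a / c"]) (simp add: matrix_mul_assoc mat_mult_mat)
  moreover have "\<exists>b. mat a ** (mat c ** g) = mat b ** g \<and> b \<noteq> 0" if "a \<noteq> 0" for a
    using assms that by (intro exI[of _ "a * c"]) (simp add: matrix_mul_assoc mat_mult_mat)
  ultimately show ?thesis unfolding pclass_eq by blast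
qed

text \<open>Homogeneous polynomials scale by a power of the factor, so vanishing can be tested on
  one representative.\<close>

lemma pclass_in_PGL_zeros:
  assumes "E \<subseteq> (\<Union>k. forms k)" "invertible g"
  shows "pclass g \<in> PGL_zeros E \<longleftrightarrow> (\<forall>F\<in>E. matrix_poly_eval F g = 0)"
proof
  assume "pclass g \<in> PGL_zeros E"
  then show "\<forall>F\<in>E. matrix_poly_eval F g = 0" using pclass_refl by (auto simp: PGL_zeros_def)
next
  assume *: "\<forall>F\<in>E. matrix_poly_eval F g = 0"
  have "matrix_poly_eval F h = 0" if F: "F \<in> E" and h: "h \<in> pclass g" for F h
  proof -
    obtain k where "F \<in> forms k" using F assms(1) by blast
    moreover obtain c where "h = mat c ** g" using h by (auto simp: pclass_eq)
    ultimately show ?thesis using * F by (simp add: matrix_poly_eval_scale)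
  qed
  then show "pclass g \<in> PGL_zeros E" using assms(2) by (auto simp: PGL_zeros_def carrier_PGL)
qed

lemma invertible_nonzero: "invertible g \<Longrightarrow> g \<noteq> (0 :: complex^'n::finite^'n)"
proof
  assume "invertible g" "g = 0"
  then have "mat 1 = (0 :: complex^'n^'n)" by (auto simp: invertible_def)
  then have "(mat 1 :: complex^'n^'n) $ i $ i = 0" for i by simp
  then show False by (simp add: mat_def)
qed

lemma t1_space_zariski_PGL: "t1_space (zariski_PGL :: (complex^'n::finite^'n) set topology)"
  unfolding t1_space_closedin_singleton topspace_zariski_PGL
proof
  fix P :: "(complex^'n^'n) set" assume P: "P \<in> carrier PGL"
  then obtain p where p: "P = pclass p" "invertible p" by (auto simp: carrier_PGL)
  \<comment> \<open>These linear forms vanish at \<open>q\<close> exactly when \<open>q\<close> is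
    proportional to \<open>p\<close>; they are the 2 by 2 minors of the pair of entry
    vectors.\<close>
  define E :: "('n \<times> 'n) cpoly set"
    where "E = {Const (p $ k $ l) * Var (i, j) - Const (p $ i $ j) * Var (k, l) | i j k l. True}"
  have E: "E \<subseteq> (\<Union>k. forms k)"
  proof
    fix F assume "F \<in> E"
    then obtain i j k l where "F = Const (p $ k $ l) * Var (i, j) + - (Const (p $ i $ j) * Var (k, l))"
      by (auto simp: E_def)
    also have "\<dots> \<in> forms 1" by (intro forms_add forms_uminus forms_Const_mult forms_Var)
    finally show "F \<in> (\<Union>k. forms k)" by blast
  qed
  have "PGL_zeros E = {P}"
  proof (intro equalityI subsetI)
    fix Q assume Q: "Q \<in> PGL_zeros E"
    then obtain q where q: "Q = pclass q" "invertible q" by (auto simp: PGL_zeros_def carrier_PGL)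
    have *: "p $ k $ l * q $ i $ j = p $ i $ j * q $ k $ l" for i j k l
    proof -
      have "Const (p $ k $ l) * Var (i, j) - Const (p $ i $ j) * Var (k, l) \<in> E"
        unfolding E_def by blast
      then have "matrix_poly_eval (Const (p $ k $ l) * Var (i, j) - Const (p $ i $ j) * Var (k, l)) q = 0"
        using Q pclass_in_PGL_zeros[OF E q(2)] q(1) by blast
      then show ?thesis by (simp add: matrix_poly_eval_def ev_simps)
    qed
    obtain k l where kl: "p $ k $ l \<noteq> 0" using invertible_nonzero[OF p(2)] by (auto simp: vec_eq_iff)
    define c where "c = q $ k $ l / p $ k $ l"
    have qc: "q = mat c ** p"
      unfolding mat_mult_left using *[of k l] kl by (simp add: vec_eq_iff c_def field_simps)
    have "c \<noteq> 0"
    proof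
      assume "c = 0"
      then have "q = 0" unfolding qc mat_mult_left by (simp add: vec_eq_iff)
      then show False using invertible_nonzero[OF q(2)] by simp
    qed
    then show "Q \<in> {P}" by (simp add: q(1) p(1) qc pclass_mat_mult)
  next
    fix Q assume "Q \<in> {P}"
    then show "Q \<in> PGL_zeros E"
      using pclass_in_PGL_zeros[OF E p(2)] by (auto simp: E_def p(1) matrix_poly_eval_def ev_simps)
  qed
  then show "closedin zariski_PGL {P}" unfolding closedin_zariski_PGL using E by blast
qed

lemma topspace_zariski_Aut: "topspace (subtopology zariski_PGL (Aut f)) = Aut f"
proof -
  have "Aut f \<subseteq> carrier PGL" by (auto simp: Aut_def carrier_PGL GL_def)
  then show ?thesis by (auto simp: topspace_zariski_PGL)
qed

section \<open>From the linear stabilizer to automorphisms\<close>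

lemma matrix_inv_eqI:
  fixes g :: "complex^'n::finite^'n"
  assumes "g ** h = mat 1" "h ** g = mat 1" shows "matrix_inv g = h"
proof -
  have "g ** matrix_inv g = mat 1 \<and> matrix_inv g ** g = mat 1"
    unfolding matrix_inv_def by (rule someI[of _ h]) (use assms in blast)
  then have "matrix_inv g = (h ** g) ** matrix_inv g" "g ** matrix_inv g = mat 1" by (simp_all add: assms)
  then show ?thesis by (simp add: matrix_mul_assoc[symmetric])
qed

lemma invertible_matrix_inv:
  fixes g :: "complex^'n::finite^'n"
  assumes "invertible g" shows "g ** matrix_inv g = mat 1" "matrix_inv g ** g = mat 1"
proof -
  have "g ** matrix_inv g = mat 1 \<and> matrix_inv g ** g = mat 1"
    unfolding matrix_inv_def using assms someI_ex unfolding invertible_def by (metis (mono_tags, lifting))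
  then show "g ** matrix_inv g = mat 1" "matrix_inv g ** g = mat 1" by simp_all
qed

lemma complex_root_exists:
  fixes w :: complex assumes "n > 0" shows "\<exists>z. z ^ n = w"
proof (cases "w = 0")
  case False
  have "exp (Ln w / of_nat n) ^ n = exp (of_nat n * (Ln w / of_nat n))" by (rule exp_of_nat_mult[symmetric])
  then show ?thesis using assms False by (intro exI[of _ "exp (Ln w / of_nat n)"]) simp
qed (use assms in auto)

lemma mat_mult_vec: "mat c *v v = (\<chi> i. c * v $ i)" for v :: "complex^'n::finite"
proof -
  have "(\<Sum>j\<in>UNIV. (if i = j then c else 0) * v $ j) = (\<Sum>j\<in>UNIV. if i = j then c * v $ j else 0)" for i
    by (intro sum.cong) auto
  then show ?thesis by (simp add: matrix_vector_mult_def mat_def vec_eq_iff)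
qed

text \<open>Complex numbers have roots, so a representative can be rescaled until it fixes
  \<open>f\<close> itself and not only up to the factor \<open>c\<close>. The inverse in the image
  reflects that \<open>Aut\<close> is defined through composition with
  \<open>matrix_inv g\<close>.\<close>

lemma finite_Aut:
  fixes f :: "'n::finite cpoly"
  assumes f: "f \<in> forms (Suc k)"
    and fin: "finite {g. invertible g \<and> (\<forall>v. ev (($) (g *v v)) f = ev (($) v) f)}" (is "finite ?V")
  shows "finite (Aut f)"
proof (rule finite_subset)
  show "Aut f \<subseteq> (\<lambda>h. pclass (matrix_inv h)) ` ?V"
  proof
    fix P assume "P \<in> Aut f"
    then obtain g c where P: "P = pclass g" and g: "invertible g" and c: "c \<noteq> 0"
      and fc: "compose_linear f (matrix_inv g) = Const c * f"
      by (auto simp: Aut_def GL_def)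
    \<comment> \<open>Scaling the argument by \<open>\<mu>\<close> multiplies \<open>f\<close> by
      \<open>\<mu>\<close> to the power \<open>Suc k\<close>, which cancels
      \<open>c\<close>.\<close>
    obtain \<mu> where \<mu>: "\<mu> ^ Suc k = inverse c" using complex_root_exists by blast
    have \<mu>0: "\<mu> \<noteq> 0" using \<mu> c by auto
    define h where "h = mat \<mu> ** matrix_inv g"
    have inv: "h ** (mat (inverse \<mu>) ** g) = mat 1" "(mat (inverse \<mu>) ** g) ** h = mat 1"
    proof -
      have "h ** (mat (inverse \<mu>) ** g) = mat \<mu> ** (matrix_inv g ** mat (inverse \<mu>)) ** g"
        by (simp add: h_def matrix_mul_assoc)
      also have "matrix_inv g ** mat (inverse \<mu>) = mat (inverse \<mu>) ** matrix_inv g"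
        by (simp only: mat_mult_left mat_mult_right)
      also have "mat \<mu> ** (mat (inverse \<mu>) ** matrix_inv g) ** g
        = (mat \<mu> ** mat (inverse \<mu>)) ** (matrix_inv g ** g)" by (simp add: matrix_mul_assoc)
      also have "\<dots> = mat 1" using \<mu>0 by (simp add: invertible_matrix_inv[OF g] mat_mult_mat)
      finally show 1: "h ** (mat (inverse \<mu>) ** g) = mat 1" .
      then show "(mat (inverse \<mu>) ** g) ** h = mat 1" by (simp add: matrix_left_right_inverse)
    qed
    have "ev (($) (h *v v)) f = ev (($) v) f" for v
    proof -
      have "h *v v = (\<chi> i. \<mu> * (matrix_inv g *v v) $ i)"
        by (simp add: h_def matrix_vector_mul_assoc[symmetric] mat_mult_vec)
      then have "ev (($) (h *v v)) f = \<mu> ^ Suc k * ev (($) (matrix_inv g *v v)) f"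
        by (simp only: vec_nth_lambda ev_scale[OF f])
      also have "\<dots> = \<mu> ^ Suc k * (c * ev (($) v) f)"
        unfolding ev_compose_linear[symmetric] fc by (simp add: poly_eval_mult)
      finally show ?thesis using c unfolding \<mu> by simp
    qed
    then have "h \<in> ?V" using inv by (auto simp: invertible_def)
    moreover have "P = pclass (matrix_inv h)"
      unfolding matrix_inv_eqI[OF inv] P using \<mu>0 by (intro pclass_mat_mult[symmetric]) simp
    ultimately show "P \<in> (\<lambda>h. pclass (matrix_inv h)) ` ?V" by blast
  qed
qed (use fin in blast)

text \<open>If \<open>g\<close> kills \<open>u\<close>, then
  \<open>f (v + t u) = f (g v) = f v\<close>, so \<open>f\<close> is constant along \<open>u\<close>
  and hence a cone. This gives invertibility along the one-parameter group without its group
  law.\<close>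

lemma stabilizer_invertible:
  fixes f :: "'n::finite cpoly"
  assumes nc: "\<not> is_cone f" and g: "\<And>v. ev (($) (g *v v)) f = ev (($) v) f"
  shows "invertible g"
proof -
  have "u = 0" if u: "g *v u = 0" for u
  proof (rule ccontr)
    assume "u \<noteq> 0"
    then obtain k where k: "u $ k \<noteq> 0" by (auto simp: vec_eq_iff)
    have "(\<Sum>i\<in>UNIV. Const (u $ i) * pdiff i f) = 0"
    proof (rule vec_cpoly_eqI)
      fix v :: "complex^'n"
      define X where "X t = v + (\<chi> i. t * u $ i)" for t :: complex
      have "g *v X t = g *v v" for t
      proof -
        have "(\<chi> i. t * u $ i) = mat t *v u" by (simp add: mat_mult_vec)
        then have "g *v (\<chi> i. t * u $ i) = mat t *v (g *v u)"
          by (simp add: matrix_vector_mul_assoc mat_mult_left mat_mult_right)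
        then show ?thesis by (simp add: X_def matrix_vector_right_distrib u)
      qed
      then have "ev (($) (X t)) f = ev (($) v) f" for t using g by metis
      moreover have "((\<lambda>t. ev (($) (X t)) f) has_field_derivative
        (\<Sum>i\<in>UNIV. u $ i * ev (($) (X 0)) (pdiff i f))) (at 0)"
        by (rule has_field_derivative_ev) (auto simp: X_def intro!: derivative_eq_intros)
      ultimately have "((\<lambda>t. ev (($) v) f) has_field_derivative
        (\<Sum>i\<in>UNIV. u $ i * ev (($) (X 0)) (pdiff i f))) (at 0)" by simp
      then have "(\<Sum>i\<in>UNIV. u $ i * ev (($) (X 0)) (pdiff i f)) = 0"
        using DERIV_unique DERIV_const by blast
      moreover have "X 0 = v" by (simp add: X_def vec_eq_iff)
      ultimately show "ev (($) v) (\<Sum>i\<in>UNIV. Const (u $ i) * pdiff i f) = ev (($) v) 0"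
        by (simp add: ev_simps)
    qed
    then show False using is_coneI[of "($) u" k f] k nc by blast
  qed
  then show ?thesis using invertible_left_inverse[of g] matrix_left_invertible_ker[of g] by blast
qed

section \<open>One-parameter groups and positive dimension\<close>

text \<open>The matrix exponential, built entrywise as a power series. Later steps use its initial
  value and its differential equation.\<close>

lemma one_parameter_group:
  fixes A :: "complex^'n::finite^'n"
  shows "\<exists>E. E 0 = mat 1 \<and> (\<forall>t i j. ((\<lambda>t. E t $ i $ j) has_field_derivative (A ** E t) $ i $ j) (at t))"
proof -
  define a where "a n = (((**) A) ^^ n) (mat 1)" for n
  have a_Suc: "a (Suc n) $ i $ j = (\<Sum>l\<in>UNIV. A $ i $ l * a n $ l $ j)" for n i j
    by (simp add: a_def matrix_matrix_mult_def)
  \<comment> \<open>\<open>K\<close> dominates every row sum of norms, so the entries of the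
    \<open>n\<close>-th power of \<open>A\<close> are at most \<open>K ^ n\<close> and the series is
    compared with an exponential series.\<close>
  define K where "K = (\<Sum>i\<in>UNIV. \<Sum>j\<in>UNIV. norm (A $ i $ j))"
  have K: "K \<ge> 0" by (simp add: K_def sum_nonneg)
  have bound: "norm (a n $ i $ j) \<le> K ^ n" for n i j
  proof (induction n arbitrary: i j)
    case 0
    then show ?case by (simp add: a_def mat_def)
  next
    case (Suc n)
    have "norm (a (Suc n) $ i $ j) \<le> (\<Sum>l\<in>UNIV. norm (A $ i $ l) * norm (a n $ l $ j))"
      unfolding a_Suc by (rule order_trans[OF norm_sum]) (simp add: norm_mult)
    also have "\<dots> \<le> (\<Sum>l\<in>UNIV. norm (A $ i $ l) * K ^ n)"
      by (intro sum_mono mult_left_mono Suc) auto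
    also have "\<dots> = (\<Sum>l\<in>UNIV. norm (A $ i $ l)) * K ^ n" by (simp add: sum_distrib_right)
    also have "\<dots> \<le> K * K ^ n"
      unfolding K_def by (intro mult_right_mono member_le_sum[of i UNIV "\<lambda>i. \<Sum>j\<in>UNIV. norm (A $ i $ j)"])
        (auto simp: sum_nonneg)
    finally show ?case by simp
  qed
  define c where "c i j n = a n $ i $ j / fact n" for i j n
  have summ: "summable (\<lambda>n. c i j n * t ^ n)" for i j t
  proof (rule summable_comparison_test)
    show "\<exists>N. \<forall>n\<ge>N. norm (c i j n * t ^ n) \<le> inverse (fact n) * (K * norm t) ^ n"
    proof (intro exI allI impI)
      fix n
      have "norm (c i j n * t ^ n) = inverse (fact n) * (norm (a n $ i $ j) * norm t ^ n)"
        by (simp add: c_def norm_mult norm_divide norm_power field_simps)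
      also have "\<dots> \<le> inverse (fact n) * (K ^ n * norm t ^ n)"
        by (intro mult_left_mono mult_right_mono bound) auto
      finally show "norm (c i j n * t ^ n) \<le> inverse (fact n) * (K * norm t) ^ n"
        by (simp add: power_mult_distrib)
    qed
    show "summable (\<lambda>n. inverse (fact n) * (K * norm t) ^ n)" by (rule summable_exp)
  qed
  \<comment> \<open>Differentiating the series formally shifts the powers of \<open>A\<close> by
    one, which is multiplication by \<open>A\<close> on the left.\<close>
  have diffs_c: "diffs (c i j) n = (\<Sum>l\<in>UNIV. A $ i $ l * c l j n)" for i j n
  proof -
    have "of_nat (Suc n) * (x / fact (Suc n)) = x / fact n" for x :: complex
      by (simp add: field_simps del: of_nat_Suc)
    then show ?thesis by (simp only: diffs_def c_def a_Suc) (simp add: sum_divide_distrib)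
  qed
  define E where "E t = (\<chi> i j. suminf (\<lambda>n. c i j n * t ^ n))" for t
  have "E 0 = mat 1"
  proof -
    have "suminf (\<lambda>n. c i j n * 0 ^ n) = c i j 0" for i j by (rule powser_zero)
    then show ?thesis by (simp add: E_def vec_eq_iff) (simp add: c_def a_def)
  qed
  moreover have "((\<lambda>t. E t $ i $ j) has_field_derivative (A ** E t) $ i $ j) (at t)" for t i j
  proof -
    have "suminf (\<lambda>n. diffs (c i j) n * t ^ n)
      = suminf (\<lambda>n. \<Sum>l\<in>UNIV. A $ i $ l * (c l j n * t ^ n))"
      by (simp add: diffs_c sum_distrib_left sum_distrib_right mult_ac)
    also have "\<dots> = (\<Sum>l\<in>UNIV. suminf (\<lambda>n. A $ i $ l * (c l j n * t ^ n)))"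
      by (rule suminf_sum) (rule summable_mult[OF summ])
    also have "\<dots> = (\<Sum>l\<in>UNIV. A $ i $ l * suminf (\<lambda>n. c l j n * t ^ n))"
      by (intro sum.cong refl suminf_mult summ)
    also have "\<dots> = (A ** E t) $ i $ j" by (simp add: matrix_matrix_mult_def E_def)
    finally show ?thesis
      using termdiffs_strong_converges_everywhere[OF summ, of i j t] by (simp add: E_def)
  qed
  ultimately show ?thesis by blast
qed

text \<open>If \<open>h\<close> is nonzero at \<open>s\<close>, it is nonzero on a ball around
  \<open>s\<close>. Then \<open>g\<close> vanishes on that ball and, by the identity theorem,
  everywhere.\<close>

lemma entire_mult_eq_0:
  fixes g h :: "complex \<Rightarrow> complex"
  assumes "g holomorphic_on UNIV" "h holomorphic_on UNIV" "\<And>t. g t * h t = 0"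
  shows "(\<forall>t. g t = 0) \<or> (\<forall>t. h t = 0)"
proof (rule disjCI, rule allI)
  fix t assume "\<not> (\<forall>t. h t = 0)"
  then obtain s where s: "h s \<noteq> 0" by blast
  have "isCont h s"
    using assms(2) holomorphic_on_imp_continuous_on continuous_on_eq_continuous_at open_UNIV by blast
  then obtain e where e: "e > 0" "\<And>z. dist s z < e \<Longrightarrow> h z \<noteq> 0"
    using s continuous_at_avoid by blast
  have "g z = 0" if "z \<in> ball s e" for z using e(2)[of z] assms(3)[of z] that by auto
  moreover have "s islimpt ball s e" using e(1) by (simp add: islimpt_ball)
  ultimately show "g t = 0"
    using analytic_continuation[OF assms(1) open_UNIV connected_UNIV, of "ball s e" s t] by simp
qed

text \<open>By the Euler formula a scalar matrix \<open>mat a\<close> acts on \<open>f\<close> as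
  multiplication by \<open>a\<close> times the degree. Nonzero infinitesimal symmetries are
  therefore not scalar and remain visible in the projective group.\<close>

lemma infinitesimal_symmetry_mat:
  fixes f :: "'n::finite cpoly"
  assumes f: "f \<in> forms (Suc k)" "f \<noteq> 0" and a: "infinitesimal_symmetry f (mat a)"
  shows "a = 0"
proof (rule ccontr)
  assume "a \<noteq> 0"
  have "f = 0"
  proof (rule vec_cpoly_eqI)
    fix v :: "complex^'n"
    have "0 = (\<Sum>i\<in>UNIV. a * (v $ i * ev (($) v) (pdiff i f)))"
      using a by (simp add: infinitesimal_symmetry_def mat_mult_vec mult_ac)
    also have "\<dots> = a * (of_nat (Suc k) * ev (($) v) f)"
      unfolding sum_distrib_left[symmetric] euler[OF f(1)] ..
    finally show "ev (($) v) f = ev (($) v) 0" using \<open>a \<noteq> 0\<close> by (simp del: of_nat_Suc)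
  qed
  then show False using f(2) by simp
qed

text \<open>The derivative of the value of \<open>f\<close> along \<open>E t *v v\<close> is the
  symmetry condition for \<open>A\<close> at that point, so the value stays equal to its initial
  value \<open>f v\<close>.\<close>

lemma one_parameter_group_Aut:
  fixes f :: "'n::finite cpoly"
  assumes nc: "\<not> is_cone f" and A: "infinitesimal_symmetry f A"
    and E0: "E 0 = mat 1"
    and E': "\<And>t i j. ((\<lambda>t. E t $ i $ j) has_field_derivative (A ** E t) $ i $ j) (at t)"
  shows "invertible (E t)" "pclass (E t) \<in> Aut f"
proof -
  have inv: "ev (($) (E t *v v)) f = ev (($) v) f" for t v
  proof -
    have "((\<lambda>t. ev (($) (E t *v v)) f) has_field_derivative 0) (at t)" for t
    proof -
      have "((\<lambda>t. (E t *v v) $ i) has_field_derivative (A *v (E t *v v)) $ i) (at t)" for i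
      proof -
        have "((\<lambda>t. \<Sum>j\<in>UNIV. E t $ i $ j * v $ j) has_field_derivative (\<Sum>j\<in>UNIV. (A ** E t) $ i $ j * v $ j)) (at t)"
          by (intro DERIV_sum DERIV_cmult_right E')
        then show ?thesis
          by (simp add: matrix_vector_mul_assoc) (simp add: matrix_vector_mult_def)
      qed
      then have "((\<lambda>t. ev (($) (E t *v v)) f) has_field_derivative
        (\<Sum>i\<in>UNIV. (A *v (E t *v v)) $ i * ev (($) (E t *v v)) (pdiff i f))) (at t)"
        by (rule has_field_derivative_ev)
      then show ?thesis using A by (simp add: infinitesimal_symmetry_def)
    qed
    then obtain c where "\<And>t. ev (($) (E t *v v)) f = c"
      using has_field_derivative_zero_constant[of UNIV "\<lambda>t. ev (($) (E t *v v)) f"] by auto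
    then show ?thesis using E0 by (metis matrix_vector_mul_lid)
  qed
  show g: "invertible (E t)" by (rule stabilizer_invertible[OF nc inv])
  have "compose_linear f (matrix_inv (E t)) = Const 1 * f"
  proof (rule vec_cpoly_eqI)
    fix v
    show "ev (($) v) (compose_linear f (matrix_inv (E t))) = ev (($) v) (Const 1 * f)"
      unfolding ev_compose_linear using inv[of t "matrix_inv (E t) *v v"]
      by (simp add: matrix_vector_mul_assoc invertible_matrix_inv[OF g])
  qed
  then show "pclass (E t) \<in> Aut f"
    using g unfolding Aut_def GL_def by (auto intro!: exI[of _ "E t"] exI[of _ "1 :: complex"])
qed

lemma krull_dim_Aut_pos:
  fixes f :: "'n::finite cpoly"
  assumes f: "f \<in> forms (Suc k)" "f \<noteq> 0" and nc: "\<not> is_cone f"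
    and A: "A \<noteq> 0" "infinitesimal_symmetry f A"
  shows "krull_dim (subtopology zariski_PGL (Aut f)) > 0"
proof -
  let ?T = "subtopology zariski_PGL (Aut f)"
  obtain E where E0: "E 0 = mat 1"
    and E': "\<And>t i j. ((\<lambda>t. E t $ i $ j) has_field_derivative (A ** E t) $ i $ j) (at t)"
    using one_parameter_group[of A] by blast
  note E_inv = one_parameter_group_Aut(1)[OF nc A(2) E0 E']
    and E_Aut = one_parameter_group_Aut(2)[OF nc A(2) E0 E']
  \<comment> \<open>All homogeneous equations satisfied along the curve; \<open>Z\<close> is thus
    the closure of the curve inside \<open>Aut f\<close>.\<close>
  define I where "I = {F \<in> (\<Union>k. forms k). \<forall>t. matrix_poly_eval F (E t) = 0}"
  have I: "I \<subseteq> (\<Union>k. forms k)" by (auto simp: I_def)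
  define Z where "Z = PGL_zeros I \<inter> Aut f"
  have mem: "pclass (E t) \<in> Z" for t
    using E_Aut pclass_in_PGL_zeros[OF I E_inv] by (auto simp: Z_def I_def)
  have hol: "(\<lambda>t. matrix_poly_eval F (E t)) holomorphic_on UNIV" for F
  proof -
    have "\<exists>D. ((\<lambda>t. matrix_poly_eval F (E t)) has_field_derivative D) (at t)" for t
      unfolding matrix_poly_eval_def
      by (rule exI, rule has_field_derivative_ev[where X' = "\<lambda>p. (A ** E t) $ fst p $ snd p"])
        (simp add: case_prod_beta E')
    then show ?thesis by (simp add: holomorphic_on_open)
  qed
  have closed_max: "Z \<subseteq> C" if C: "closedin ?T C" "\<And>t. pclass (E t) \<in> C" for C
  proof -
    obtain E1 where E1: "E1 \<subseteq> (\<Union>k. forms k)" "C = PGL_zeros E1 \<inter> Aut f"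
      using C(1) unfolding closedin_subtopology closedin_zariski_PGL by blast
    have "E1 \<subseteq> I"
      using C(2) E1(1) pclass_in_PGL_zeros[OF E1(1) E_inv] by (auto simp: E1(2) I_def)
    then show ?thesis by (auto simp: Z_def E1(2) PGL_zeros_def)
  qed
  have Z: "irreducible_closed ?T Z"
    unfolding irreducible_closed_def
  proof (intro conjI allI impI)
    show "closedin ?T Z"
      unfolding closedin_subtopology closedin_zariski_PGL Z_def using I by blast
    show "Z \<noteq> {}" using mem by blast
  next
    fix C D assume CD: "closedin ?T C \<and> closedin ?T D \<and> Z = C \<union> D"
    obtain E1 where E1: "E1 \<subseteq> (\<Union>k. forms k)" "C = PGL_zeros E1 \<inter> Aut f"
      using CD unfolding closedin_subtopology closedin_zariski_PGL by blast
    obtain E2 where E2: "E2 \<subseteq> (\<Union>k. forms k)" "D = PGL_zeros E2 \<inter> Aut f"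
      using CD unfolding closedin_subtopology closedin_zariski_PGL by blast
    \<comment> \<open>If the curve lay in neither piece, some \<open>F\<close> and \<open>G\<close>
      would be nonzero entire functions along it, while their product vanishes because each point
      lies in one of the two pieces.\<close>
    have "(\<forall>t. pclass (E t) \<in> C) \<or> (\<forall>t. pclass (E t) \<in> D)"
    proof (rule ccontr)
      assume "\<not> ?thesis"
      then obtain F s G t where F: "F \<in> E1" "matrix_poly_eval F (E s) \<noteq> 0"
        and G: "G \<in> E2" "matrix_poly_eval G (E t) \<noteq> 0"
        using E_Aut pclass_in_PGL_zeros[OF E1(1) E_inv] pclass_in_PGL_zeros[OF E2(1) E_inv]
        unfolding E1(2) E2(2) by blast
      have "matrix_poly_eval F (E r) * matrix_poly_eval G (E r) = 0" for r
      proof -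
        have "pclass (E r) \<in> PGL_zeros E1 \<or> pclass (E r) \<in> PGL_zeros E2"
          using mem[of r] CD E1(2) E2(2) by blast
        then show ?thesis
          using F(1) G(1) pclass_in_PGL_zeros[OF E1(1) E_inv] pclass_in_PGL_zeros[OF E2(1) E_inv]
          by auto
      qed
      from entire_mult_eq_0[OF hol hol this] show False using F(2) G(2) by blast
    qed
    then show "Z = C \<or> Z = D" using closed_max CD by blast
  qed
  have t1: "t1_space ?T" by (rule t1_space_subtopology[OF t1_space_zariski_PGL])
  \<comment> \<open>The point of the identity is the lower member of the chain and \<open>Z\<close>
    the upper one; the inclusion is proper if the curve leaves this point.\<close>
  let ?P = "{pclass (E 0)}"
  have "closedin ?T ?P"
    using t1 E_Aut[of 0] unfolding t1_space_closedin_singleton topspace_zariski_Aut by blast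
  then have P: "irreducible_closed ?T ?P" by (auto simp: irreducible_closed_def singleton_Un_iff)
  have "\<not> (\<forall>t. pclass (E t) = pclass (E 0))"
  proof
    assume *: "\<forall>t. pclass (E t) = pclass (E 0)"
    have "\<exists>c. E t = mat c" for t
    proof -
      have "E t \<in> pclass (E 0)" using * pclass_refl by metis
      then show ?thesis by (auto simp: pclass_eq E0)
    qed
    \<comment> \<open>A curve of scalar matrices has a scalar derivative at 0, and this derivative
      is \<open>A\<close>.\<close>
    then obtain c where c: "\<And>t. E t = mat (c t)" by metis
    have deriv: "((\<lambda>t. (if i = j then c t else 0)) has_field_derivative A $ i $ j) (at 0)" for i j
    proof -
      have "((\<lambda>t. E t $ i $ j) has_field_derivative A $ i $ j) (at 0)"
        using E'[of i j 0] by (simp add: E0)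
      then show ?thesis by (simp add: c mat_def)
    qed
    obtain i0 :: 'n where True by blast
    obtain a where a: "A $ i0 $ i0 = a" by blast
    have "A $ i $ j = (if i = j then a else 0)" for i j
    proof (cases "i = j")
      case True
      then show ?thesis using DERIV_unique[of c "A $ i $ j" 0] deriv[of i j] deriv[of i0 i0] a by simp
    next
      case False
      then have "((\<lambda>t. 0) has_field_derivative A $ i $ j) (at 0)" using deriv[of i j] by simp
      then have "A $ i $ j = 0" using DERIV_const by (rule DERIV_unique)
      then show ?thesis using False by simp
    qed
    then have A': "A = mat a" by (simp add: mat_def vec_eq_iff)
    have "a = 0" by (rule infinitesimal_symmetry_mat[OF f]) (use A(2) A' in simp)
    then show False using A(1) A' by (simp add: mat_def vec_eq_iff)
  qed
  then have "?P \<subset> Z" using mem by blast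
  then show ?thesis unfolding krull_dim_pos_iff using P Z by blast
qed

lemma krull_dim_Aut_pos_iff:
  fixes f :: "'n::finite cpoly"
  assumes f: "f \<in> forms (Suc k)" "f \<noteq> 0" and nc: "\<not> is_cone f"
  shows "krull_dim (subtopology zariski_PGL (Aut f)) > 0 \<longleftrightarrow> (\<exists>B. B \<noteq> 0 \<and> infinitesimal_symmetry f B)"
proof
  assume pos: "krull_dim (subtopology zariski_PGL (Aut f)) > 0"
  show "\<exists>B. B \<noteq> 0 \<and> infinitesimal_symmetry f B"
  proof (rule ccontr)
    assume "\<not> (\<exists>B. B \<noteq> 0 \<and> infinitesimal_symmetry f B)"
    then have "finite (Aut f)" using finite_Aut[OF f(1) finite_linear_stabilizer[OF f(1)]] by blast
    then have "finite (topspace (subtopology zariski_PGL (Aut f)))" by (simp only: topspace_zariski_Aut)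
    then show False
      using pos krull_dim_finite_t1_space t1_space_subtopology t1_space_zariski_PGL by blast
  qed
qed (use krull_dim_Aut_pos[OF f nc] in blast)

section \<open>The equivalence of the five conditions\<close>

theorem proposition2p8:
  fixes n d :: nat and f :: "'n::finite cpoly"
  assumes "CARD('n) = n + 1" and "n \<ge> 1" and "d \<ge> 3"
    and "f \<noteq> 0" and "f \<in> forms d"
    and "\<not> is_cone f"
  defines "stmt1 \<equiv> indeg (Syz f) = 1"
    and "stmt2 \<equiv> \<exists>c :: 'n \<Rightarrow> 'n \<Rightarrow> complex. (\<exists>i j. c i j \<noteq> 0) \<and>
          (\<Sum>i\<in>UNIV. \<Sum>j\<in>UNIV. Const (c i j) * (Var j * pdiff i f)) = 0"
    and "stmt3 \<equiv> dim_jacobian_ideal f d < (n + 1)\<^sup>2"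
    and "stmt4 \<equiv> int (dim_jacobian_algebra f d) > int ((n + d) choose n) - int ((n + 1)\<^sup>2)"
    and "stmt5 \<equiv> krull_dim (subtopology zariski_PGL (Aut f)) > 0"
  shows "(stmt1 \<longleftrightarrow> stmt2) \<and> (stmt2 \<longleftrightarrow> stmt3) \<and> (stmt3 \<longleftrightarrow> stmt4) \<and> (stmt4 \<longleftrightarrow> stmt5)"
proof -
  obtain k where d: "d = Suc k" and k: "k > 0" using assms(3) by (cases d) auto
  have f: "f \<in> forms (Suc k)" using assms(5) d by simp
  let ?sym = "\<exists>B. B \<noteq> 0 \<and> infinitesimal_symmetry f B"
  have 1: "stmt1 \<longleftrightarrow> ?sym"
    unfolding stmt1_def by (rule indeg_Syz_eq_1_iff[OF f assms(6)]) (use assms(1,2) in simp)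
  have 2: "stmt2 \<longleftrightarrow> ?sym" unfolding stmt2_def by (rule ex_infinitesimal_symmetry_iff[symmetric])
  have 3: "stmt2 \<longleftrightarrow> stmt3"
  proof -
    let ?p = "\<lambda>(i, j). Var j * pdiff i f"
    \<comment> \<open>The forms are treated as a family indexed by pairs, whose index type has
      \<open>(n + 1)^2\<close> elements even if some of the forms coincide.\<close>
    have "stmt3 \<longleftrightarrow> cpoly.dim (range ?p) < CARD('n \<times> 'n)"
      unfolding stmt3_def d dim_jacobian(1)[OF f k] by (simp add: assms(1) power2_eq_square)
    also have "\<dots> \<longleftrightarrow> (\<exists>c. (\<exists>p. c p \<noteq> 0) \<and> (\<Sum>p\<in>UNIV. Const (c p) * ?p p) = 0)"
      by (rule dim_range_less_iff)
    also have "\<dots> \<longleftrightarrow> stmt2"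
    proof
      assume "\<exists>c. (\<exists>p. c p \<noteq> 0) \<and> (\<Sum>p\<in>UNIV. Const (c p) * ?p p) = 0"
      then obtain c where "\<exists>p. c p \<noteq> 0" "(\<Sum>p\<in>UNIV. Const (c p) * ?p p) = 0" by blast
      then show stmt2 unfolding stmt2_def
        by (intro exI[of _ "\<lambda>i j. c (i, j)"]) (auto simp: sum_UNIV_prod)
    next
      assume stmt2
      then obtain c where "\<exists>i j. c i j \<noteq> 0"
        "(\<Sum>i\<in>UNIV. \<Sum>j\<in>UNIV. Const (c i j) * (Var j * pdiff i f)) = 0"
        unfolding stmt2_def by blast
      then show "\<exists>c. (\<exists>p. c p \<noteq> 0) \<and> (\<Sum>p\<in>UNIV. Const (c p) * ?p p) = 0"
        by (intro exI[of _ "\<lambda>(i, j). c i j"]) (auto simp: sum_UNIV_prod)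
    qed
    finally show ?thesis by blast
  qed
  have 4: "stmt3 \<longleftrightarrow> stmt4"
  proof -
    have "(CARD('n) + k) choose (Suc k) = (n + d) choose n"
      using binomial_symmetric[of n "n + d"] by (simp add: assms(1) d)
    then have "dim_jacobian_ideal f d + dim_jacobian_algebra f d = (n + d) choose n"
      using dim_jacobian(2)[OF f k] d by simp
    \<comment> \<open>The two dimensions add up to the binomial coefficient. The comparison is made
      over the integers, where the difference in (4) is not truncated when it is negative.\<close>
    then have "int ((n + d) choose n) = int (dim_jacobian_ideal f d) + int (dim_jacobian_algebra f d)"
      by linarith
    then show ?thesis unfolding stmt3_def stmt4_def by linarith
  qed
  have 5: "stmt5 \<longleftrightarrow> ?sym"
    unfolding stmt5_def by (rule krull_dim_Aut_pos_iff[OF f assms(4,6)])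
  show ?thesis using 1 2 3 4 5 by blast
qed

end
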